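(* Let $n\ge1$, $N=4^n$, $m=(N-4)/6$. Let $S^*\subseteq(\mathbb Z/N\mathbb Z)^3$ consist of the points $(k,\ N/2-1-2k,\ N/2+k)$ for $k=0,1,\dots,m$, together with the points $\big((4N+2)/6+k,\ (5N+4)/6+k,\ N/2-2-2k\big)$ for $k=0,1,\dots,m-1$. Let $S=\{(x,y,z): (x,y,z)\in S^*\text{ or }(y,z,x)\in S^*\text{ or }(z,x,y)\in S^*\}$. Then $S$ is a merging set, and the Hamilton decomposition $\{X,Y,Z\}$ of $G_{n,3}$ obtained by merging the cubes with origins in $S$ is Latin: $\sigma_2(X)=Y$ and $\sigma_3(X)=Z$, where $\sigma_2,\sigma_3$ are the permutations of $\{1,2,3\}$ given by $\sigma_i(j)\equiv i+j-1\pmod 3$. Consequently $X$ (directed, starting at the origin) is a source cycle for $G_{n,3}$ with source matrix $\begin{pmatrix}1&2&3\\2&3&1\\3&1&2\end{pmatrix}$.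
   Context: $G_{n,3}$ has vertex set $(\mathbb Z/N\mathbb Z)^3$, $N=4^n$, adjacency: differ in exactly one coordinate by $\pm1\pmod N$. Initial partition: for each vertex $(x,y,z)$ with $s=x+y+z$, the edge $(x,y,z)(x+1,y,z)$ is in $Z$ if $s\equiv-1$ else $X$; $(x,y,z)(x,y+1,z)$ is in $X$ if $s\equiv-1$ else $Y$; $(x,y,z)(x,y,z+1)$ is in $Y$ if $s\equiv-1$ else $Z$. For $v=(x,y,z)$ with $x+y+z\equiv-1$, write $abc$ for $(x+a,y+b,z+c)$; merging the cube at $v$ reassigns its 12 edges from $X=\{000\text{-}010,010\text{-}110,001\text{-}101,011\text{-}111\}$, $Y=\{000\text{-}001,001\text{-}011,100\text{-}110,101\text{-}111\}$, $Z=\{000\text{-}100,100\text{-}101,010\text{-}011,110\text{-}111\}$ to $X=\{000\text{-}001,010\text{-}110,010\text{-}011,101\text{-}111\}$, $Y=\{000\text{-}100,001\text{-}101,001\text{-}011,110\text{-}111\}$, $Z=\{000\text{-}010,100\text{-}110,100\text{-}101,011\text{-}111\}$. A merging set is $S\subseteq(\mathbb Z/N\mathbb Z)^3$ with $|S|=N-1$, all elements having coordinate sum $\equiv-1$, and distinct elements differing in all three coordinates. A permutation $\sigma$ of $\{1,\dots,k\}$ acts on $G_{n,k}=C_{4^n}^{\Box k}$ (vertex set $(\mathbb Z/4^n\mathbb Z)^k$) by $\sigma(x_1,\dots,x_k)=(x_{\sigma^{-1}(1)},\dots,x_{\sigma^{-1}(k)})$; it is a graph automorphism, maps an edge in direction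 $i$ to one in direction $\sigma(i)$, and maps (directed) Hamilton cycles to (directed) Hamilton cycles. A $k\times k$ matrix $M=(m_{ij})$ that is a Latin square on $\{1,\dots,k\}$ with first row the identity defines permutations $\sigma_i(j)=m_{ij}$. A directed Hamilton cycle $H$ of $G_{n,k}$ starting at the origin is a source cycle with source matrix $M$ if $\sigma_1(H),\dots,\sigma_k(H)$ form a Hamilton decomposition (their edge sets partition the edge set); a Hamilton decomposition of this form is called Latin. *)

theory Defs
  imports Main
begin

section \<open>The graph G_{n,3} = C_N^3 with N = 4^n, vertices (Z/NZ)^3 as integer triples in [0,N)\<close>

type_synonym vtx = "int \<times> int \<times> int"

definition coord :: "vtx \<Rightarrow> nat \<Rightarrow> int" where
  "coord v i = (case v of (x, y, z) \<Rightarrow> if i = 1 then x else if i = 2 then y else z)"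

definition verts :: "int \<Rightarrow> vtx set" where
  "verts N = {(x, y, z). 0 \<le> x \<and> x < N \<and> 0 \<le> y \<and> y < N \<and> 0 \<le> z \<and> z < N}"

definition adj :: "int \<Rightarrow> vtx \<Rightarrow> vtx \<Rightarrow> bool" where
  "adj N u v \<longleftrightarrow> u \<in> verts N \<and> v \<in> verts N \<and>
     (\<exists>i\<in>{1,2,3}. ((coord u i - coord v i) mod N = 1 \<or> (coord v i - coord u i) mod N = 1)
        \<and> (\<forall>j\<in>{1,2,3}. j \<noteq> i \<longrightarrow> coord u j = coord v j))"

definition edges :: "int \<Rightarrow> vtx set set" where
  "edges N = {{u, v} | u v. adj N u v}"

definition vadd :: "int \<Rightarrow> vtx \<Rightarrow> int \<Rightarrow> int \<Rightarrow> int \<Rightarrow> vtx" where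
  "vadd N v a b c = (case v of (x, y, z) \<Rightarrow> ((x + a) mod N, (y + b) mod N, (z + c) mod N))"

definition special :: "int \<Rightarrow> vtx \<Rightarrow> bool" where
  "special N v \<longleftrightarrow> (case v of (x, y, z) \<Rightarrow> (x + y + z) mod N = (-1) mod N)"

datatype colour = CX | CY | CZ

definition init_class :: "int \<Rightarrow> colour \<Rightarrow> vtx set set" where
  "init_class N c =
     {{v, vadd N v 1 0 0} | v. v \<in> verts N \<and> c = (if special N v then CZ else CX)} \<union>
     {{v, vadd N v 0 1 0} | v. v \<in> verts N \<and> c = (if special N v then CX else CY)} \<union>
     {{v, vadd N v 0 0 1} | v. v \<in> verts N \<and> c = (if special N v then CY else CZ)}"

definition old_class :: "int \<Rightarrow> vtx \<Rightarrow> colour \<Rightarrow> vtx set set" where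
  "old_class N v c = (let p = vadd N v in case c of
      CX \<Rightarrow> {{p 0 0 0, p 0 1 0}, {p 0 1 0, p 1 1 0}, {p 0 0 1, p 1 0 1}, {p 0 1 1, p 1 1 1}}
    | CY \<Rightarrow> {{p 0 0 0, p 0 0 1}, {p 0 0 1, p 0 1 1}, {p 1 0 0, p 1 1 0}, {p 1 0 1, p 1 1 1}}
    | CZ \<Rightarrow> {{p 0 0 0, p 1 0 0}, {p 1 0 0, p 1 0 1}, {p 0 1 0, p 0 1 1}, {p 1 1 0, p 1 1 1}})"

definition new_class :: "int \<Rightarrow> vtx \<Rightarrow> colour \<Rightarrow> vtx set set" where
  "new_class N v c = (let p = vadd N v in case c of
      CX \<Rightarrow> {{p 0 0 0, p 0 0 1}, {p 0 1 0, p 1 1 0}, {p 0 1 0, p 0 1 1}, {p 1 0 1, p 1 1 1}}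
    | CY \<Rightarrow> {{p 0 0 0, p 1 0 0}, {p 0 0 1, p 1 0 1}, {p 0 0 1, p 0 1 1}, {p 1 1 0, p 1 1 1}}
    | CZ \<Rightarrow> {{p 0 0 0, p 0 1 0}, {p 1 0 0, p 1 1 0}, {p 1 0 0, p 1 0 1}, {p 0 1 1, p 1 1 1}})"

definition cube_edges :: "int \<Rightarrow> vtx \<Rightarrow> vtx set set" where
  "cube_edges N v = old_class N v CX \<union> old_class N v CY \<union> old_class N v CZ"

definition merged :: "int \<Rightarrow> vtx set \<Rightarrow> colour \<Rightarrow> vtx set set" where
  "merged N S c = (init_class N c - (\<Union>v\<in>S. cube_edges N v)) \<union> (\<Union>v\<in>S. new_class N v c)"

definition merging_set :: "int \<Rightarrow> vtx set \<Rightarrow> bool" where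
  "merging_set N S \<longleftrightarrow> S \<subseteq> verts N \<and> card S = nat (N - 1) \<and> (\<forall>v\<in>S. special N v) \<and>
     (\<forall>v\<in>S. \<forall>w\<in>S. v \<noteq> w \<longrightarrow> (\<forall>i\<in>{1,2,3}. coord v i \<noteq> coord w i))"

definition dir_ham_cycle :: "int \<Rightarrow> (nat \<Rightarrow> vtx) \<Rightarrow> bool" where
  "dir_ham_cycle N f \<longleftrightarrow> bij_betw f {..<nat (N ^ 3)} (verts N) \<and> f 0 = (0, 0, 0) \<and>
     (\<forall>i < nat (N ^ 3). adj N (f i) (f (Suc i mod nat (N ^ 3))))"

definition cycle_edges :: "int \<Rightarrow> (nat \<Rightarrow> vtx) \<Rightarrow> vtx set set" where
  "cycle_edges N f = {{f i, f (Suc i mod nat (N ^ 3))} | i. i < nat (N ^ 3)}"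

definition ham_cycle_edges :: "int \<Rightarrow> vtx set set \<Rightarrow> bool" where
  "ham_cycle_edges N H \<longleftrightarrow> (\<exists>f. dir_ham_cycle N f \<and> cycle_edges N f = H)"

definition perm_act :: "(nat \<Rightarrow> nat) \<Rightarrow> vtx \<Rightarrow> vtx" where
  "perm_act \<sigma> v = (coord v (inv \<sigma> 1), coord v (inv \<sigma> 2), coord v (inv \<sigma> 3))"

definition edge_img :: "(nat \<Rightarrow> nat) \<Rightarrow> vtx set set \<Rightarrow> vtx set set" where
  "edge_img \<sigma> H = (\<lambda>e. perm_act \<sigma> ` e) ` H"

definition latin3 :: "(nat \<Rightarrow> nat \<Rightarrow> nat) \<Rightarrow> bool" where
  "latin3 M \<longleftrightarrow> (\<forall>i\<in>{1,2,3}. bij_betw (M i) {1,2,3} {1,2,3}) \<and>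
     (\<forall>j\<in>{1,2,3}. bij_betw (\<lambda>i. M i j) {1,2,3} {1,2,3}) \<and> (\<forall>j\<in>{1,2,3}. M 1 j = j)"

definition row_perm :: "(nat \<Rightarrow> nat \<Rightarrow> nat) \<Rightarrow> nat \<Rightarrow> nat \<Rightarrow> nat" where
  "row_perm M i = (\<lambda>j. if j \<in> {1,2,3} then M i j else j)"

definition source_cycle :: "int \<Rightarrow> (nat \<Rightarrow> nat \<Rightarrow> nat) \<Rightarrow> (nat \<Rightarrow> vtx) \<Rightarrow> bool" where
  "source_cycle N M f \<longleftrightarrow> latin3 M \<and> dir_ham_cycle N f \<and>
     (\<forall>i\<in>{1,2,3}. ham_cycle_edges N (cycle_edges N (perm_act (row_perm M i) \<circ> f))) \<and>
     (\<forall>i\<in>{1,2,3}. \<forall>j\<in>{1,2,3}. i \<noteq> j \<longrightarrow>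
        cycle_edges N (perm_act (row_perm M i) \<circ> f) \<inter> cycle_edges N (perm_act (row_perm M j) \<circ> f) = {}) \<and>
     (\<Union>i\<in>{1,2,3}. cycle_edges N (perm_act (row_perm M i) \<circ> f)) = edges N"

text \<open>The source matrix ((1,2,3),(2,3,1),(3,1,2)): m_ij = i+j-1 mod 3 in {1,2,3}.\<close>
definition srcM :: "nat \<Rightarrow> nat \<Rightarrow> nat" where
  "srcM i j = (i + j - 2) mod 3 + 1"

definition S_star :: "nat \<Rightarrow> vtx set" where
  "S_star n = (let N = (4::int) ^ n; m = (N - 4) div 6 in
     {(k mod N, (N div 2 - 1 - 2 * k) mod N, (N div 2 + k) mod N) | k. 0 \<le> k \<and> k \<le> m} \<union>
     {(((4 * N + 2) div 6 + k) mod N, ((5 * N + 4) div 6 + k) mod N, (N div 2 - 2 - 2 * k) mod N)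
        | k. 0 \<le> k \<and> k \<le> m - 1})"

definition S_set :: "nat \<Rightarrow> vtx set" where
  "S_set n = {(x, y, z). (x, y, z) \<in> S_star n \<or> (y, z, x) \<in> S_star n \<or> (z, x, y) \<in> S_star n}"

end

theory Submission
  imports Defs
begin

text \<open>The initial classes decompose into cycles contained in coordinate planes, \<open>N\<close> cycles per class.
  Merging a cube joins, in each class, the two cycles that meet the cube. Cubes of a merging
  set are pairwise disjoint, and in each class they link the planes in a chain, so each class
  becomes a single Hamilton cycle. The rotation \<open>(x, y, z) \<mapsto> (z, x, y)\<close> permutes the initial classes and
  the colours of the merged cubes cyclically, and it preserves the set \<open>S_set n\<close>; hence it carries
  \<open>X\<close> to \<open>Y\<close> and \<open>Y\<close> to \<open>Z\<close>.\<close>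

section \<open>Cycles as lists\<close>

text \<open>A merge takes two edges from the layer above the cube, and the outcome depends on the
  order in which its cycle meets them. The paths left over there must join \<open>101\<close> to
  \<open>011\<close> and \<open>111\<close> to \<open>001\<close>; a path from \<open>101\<close> to
  \<open>111\<close> would be closed by the new edge \<open>101-111\<close> into a cycle of its own.
  From the lower side a single edge leaves, so there any cycle will do. This is why layers are added
  upwards only: the upper side is always an untouched initial cycle, known explicitly, and nothing
  but being a cycle has to be remembered about the lower side. Differing in all three coordinates
  does not by itself keep two cubes apart, since origins may be neighbours in a coordinate; a parity
  argument, with \<open>N\<close> even, excludes a common vertex. The set \<open>S_set n\<close> is
  built for closure under rotation. With \<open>N = 6 * m + 4\<close>, its
  \<open>N - 1 = 3 * (2 * m + 1)\<close> points are the rotations of the \<open>m + 1\<close> and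
  \<open>m\<close> points of the two progressions in \<open>S_star n\<close>. Thanks to this
  closure, only \<open>X\<close> has to be shown to be a Hamilton cycle directly.\<close>

fun path_edges :: "'a list \<Rightarrow> 'a set set" where
  "path_edges (x # y # zs) = insert {x, y} (path_edges (y # zs))"
| "path_edges _ = {}"

definition cyc_edges :: "'a list \<Rightarrow> 'a set set" where
  "cyc_edges xs = insert {last xs, hd xs} (path_edges xs)"

lemma path_edges_Cons: "xs \<noteq> [] \<Longrightarrow> path_edges (x # xs) = insert {x, hd xs} (path_edges xs)"
  by (cases xs) auto

lemma path_edges_append:
  "xs \<noteq> [] \<Longrightarrow> ys \<noteq> [] \<Longrightarrow>
     path_edges (xs @ ys) = insert {last xs, hd ys} (path_edges xs \<union> path_edges ys)"
  by (induction xs rule: path_edges.induct) (auto simp: path_edges_Cons)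

lemma path_edges_rev: "path_edges (rev xs) = path_edges xs"
proof (induction xs)
  case (Cons x xs)
  then show ?case
    by (cases "xs = []") (auto simp: path_edges_append path_edges_Cons last_rev)
qed simp

lemma path_edges_subset: "e \<in> path_edges xs \<Longrightarrow> e \<subseteq> set xs"
  by (induction xs rule: path_edges.induct) auto

lemma path_edges_split:
  assumes "e \<in> path_edges xs"
  obtains ys zs where "xs = ys @ zs" "ys \<noteq> []" "zs \<noteq> []" "e = {last ys, hd zs}"
proof -
  have "\<exists>ys zs. xs = ys @ zs \<and> ys \<noteq> [] \<and> zs \<noteq> [] \<and> e = {last ys, hd zs}"
    using assms
  proof (induction xs rule: path_edges.induct)
    case (1 x y zs)
    show ?case
    proof (cases "e = {x, y}")
      case True
      then show ?thesis by (intro exI[of _ "[x]"] exI[of _ "y # zs"]) simp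
    next
      case False
      then obtain us vs where "y # zs = us @ vs" "us \<noteq> []" "vs \<noteq> []" "e = {last us, hd vs}"
        using 1 by auto
      then show ?thesis by (intro exI[of _ "x # us"] exI[of _ vs]) simp
    qed
  qed auto
  then show thesis using that by blast
qed

lemma cyc_edges_swap: "cyc_edges (ys @ zs) = cyc_edges (zs @ ys)"
  by (cases "ys = []"; cases "zs = []") (auto simp: cyc_edges_def path_edges_append)

text \<open>With two vertices the closing edge would be the path edge itself; from three on, the
  first and last vertex are not consecutive. So opening a cycle at its closing edge removes exactly
  that edge.\<close>

lemma closing_edge_notin_path_edges:
  assumes "distinct xs" "3 \<le> length xs"
  shows "{last xs, hd xs} \<notin> path_edges xs"
proof -
  obtain a b c ys where xs: "xs = a # b # c # ys"
    using assms(2) by (cases xs; cases "tl xs"; cases "tl (tl xs)") auto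
  have "{last xs, hd xs} \<notin> path_edges (b # c # ys)"
    using path_edges_subset[of "{last xs, hd xs}" "b # c # ys"] assms(1) by (auto simp: xs)
  moreover have "last (c # ys) \<in> set (c # ys)" by (rule last_in_set) simp
  ultimately show ?thesis using assms(1) by (auto simp: xs doubleton_eq_iff)
qed

section \<open>Cutting and joining cycles\<close>

definition is_cycle_on :: "'a set \<Rightarrow> 'a set set \<Rightarrow> bool" where
  "is_cycle_on V H \<longleftrightarrow> (\<exists>xs. distinct xs \<and> 3 \<le> length xs \<and> set xs = V \<and> cyc_edges xs = H)"

lemma is_cycle_on_start:
  assumes "is_cycle_on V H" "a \<in> V"
  obtains xs where "distinct xs" "3 \<le> length xs" "set xs = V" "cyc_edges xs = H" "hd xs = a"
proof -
  obtain xs where xs: "distinct xs" "3 \<le> length xs" "set xs = V" "cyc_edges xs = H"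
    using assms(1) unfolding is_cycle_on_def by blast
  obtain ys zs where "xs = ys @ a # zs" using assms(2) xs(3) by (meson split_list)
  with xs show thesis
    by (intro that[of "a # zs @ ys"]) (auto simp: cyc_edges_swap[of ys "a # zs"])
qed

text \<open>Swapping the two parts of the list makes the given edge the closing one, and reversal
  corrects the direction if necessary. Both ends of \<open>P\<close> are prescribed because a merge
  attaches a different new edge to each of them.\<close>

lemma is_cycle_on_cut:
  assumes "is_cycle_on V H" "{a, b} \<in> H"
  obtains P where "distinct P" "3 \<le> length P" "set P = V" "path_edges P = H - {{a, b}}"
    "hd P = a" "last P = b"
proof -
  obtain xs where xs: "distinct xs" "3 \<le> length xs" "set xs = V" "cyc_edges xs = H"
    using assms(1) unfolding is_cycle_on_def by blast
  obtain Q where Q: "distinct Q" "3 \<le> length Q" "set Q = V" "cyc_edges Q = H"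
    "{a, b} = {last Q, hd Q}"
  proof (cases "{a, b} = {last xs, hd xs}")
    case True
    with xs that show thesis by blast
  next
    case False
    with assms(2) xs(4) have "{a, b} \<in> path_edges xs" by (auto simp: cyc_edges_def)
    then obtain ys zs where "xs = ys @ zs" "ys \<noteq> []" "zs \<noteq> []" "{a, b} = {last ys, hd zs}"
      by (rule path_edges_split)
    with xs show thesis
      by (intro that[of "zs @ ys"]) (auto simp: cyc_edges_swap[of ys zs])
  qed
  have path: "path_edges Q = H - {{a, b}}"
    using closing_edge_notin_path_edges[OF Q(1,2)] Q(4,5) by (auto simp: cyc_edges_def)
  show thesis
  proof (cases "hd Q = a \<and> last Q = b")
    case True
    with Q path that show thesis by blast
  next
    case False
    with Q(5) have "hd Q = b" "last Q = a" by (auto simp: doubleton_eq_iff)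
    with Q path show thesis
      by (intro that[of "rev Q"]) (auto simp: path_edges_rev hd_rev last_rev)
  qed
qed

text \<open>The cycle is \<open>P @ rev Q2 @ Q1\<close>. The reversal is dictated by the three
  joining edges: \<open>last P\<close> is linked to the end of \<open>Q2\<close>, and the start of
  \<open>Q2\<close> to the start of \<open>Q1\<close>.\<close>

lemma is_cycle_on_merge:
  assumes "distinct P" "3 \<le> length P" "distinct Q1" "distinct Q2" "Q1 \<noteq> []" "Q2 \<noteq> []"
    and "set P \<inter> set Q1 = {}" "set P \<inter> set Q2 = {}" "set Q1 \<inter> set Q2 = {}"
  shows "is_cycle_on (set P \<union> set Q1 \<union> set Q2)
    (path_edges P \<union> path_edges Q1 \<union> path_edges Q2 \<union>
      {{last P, last Q2}, {hd Q2, hd Q1}, {last Q1, hd P}})"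
  unfolding is_cycle_on_def
proof (intro exI conjI)
  have "P \<noteq> []" using assms(2) by auto
  then show "cyc_edges (P @ rev Q2 @ Q1) = path_edges P \<union> path_edges Q1 \<union> path_edges Q2 \<union>
      {{last P, last Q2}, {hd Q2, hd Q1}, {last Q1, hd P}}"
    using assms by (simp add: cyc_edges_def path_edges_append path_edges_rev hd_rev last_rev) blast
qed (use assms in auto)

text \<open>This translates the list form of a cycle into the indexed form of
  \<open>cycle_edges\<close>, where the closing edge arises from
  \<open>Suc i mod length xs = 0\<close>.\<close>

lemma cyc_edges_nth:
  assumes "xs \<noteq> []"
  shows "cyc_edges xs = {{xs ! i, xs ! (Suc i mod length xs)} | i. i < length xs}"
proof -
  have path: "path_edges xs = {{xs ! i, xs ! Suc i} | i. Suc i < length xs}" for xs :: "'a list"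
  proof (induction xs rule: path_edges.induct)
    case (1 x y zs)
    have "{{(x # y # zs) ! i, (x # y # zs) ! Suc i} | i. Suc i < length (x # y # zs)} =
      insert {x, y} {{(y # zs) ! i, (y # zs) ! Suc i} | i. Suc i < length (y # zs)}"
      (is "?A = insert _ ?B")
    proof (intro equalityI subsetI)
      fix e assume "e \<in> ?A"
      then obtain i where i: "e = {(x # y # zs) ! i, (x # y # zs) ! Suc i}"
        "Suc i < length (x # y # zs)" by blast
      then show "e \<in> insert {x, y} ?B" by (cases i) auto
    next
      fix e assume "e \<in> insert {x, y} ?B"
      then consider "e = {x, y}" | i where "e = {(y # zs) ! i, (y # zs) ! Suc i}"
        "Suc i < length (y # zs)" by blast
      then show "e \<in> ?A"
      proof cases
        case 1
        then show ?thesis by (auto intro!: exI[of _ 0])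
      next
        case (2 i)
        then show ?thesis by (auto intro!: exI[of _ "Suc i"])
      qed
    qed
    then show ?case using 1 by simp
  qed auto
  let ?n = "length xs"
  have n: "Suc (?n - 1) = ?n" using assms by (cases xs) auto
  have "{{xs ! i, xs ! (Suc i mod ?n)} | i. i < ?n} =
    insert {xs ! (?n - 1), xs ! 0} {{xs ! i, xs ! Suc i} | i. Suc i < ?n}"
    (is "?A = insert _ ?B")
  proof (intro equalityI subsetI)
    fix e assume "e \<in> ?A"
    then obtain i where i: "e = {xs ! i, xs ! (Suc i mod ?n)}" "i < ?n" by blast
    show "e \<in> insert {xs ! (?n - 1), xs ! 0} ?B"
    proof (cases "Suc i < ?n")
      case True with i show ?thesis by auto
    next
      case False
      with i have "Suc i = ?n" by simp
      then have "i = ?n - 1" "Suc i mod ?n = 0" by auto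
      with i show ?thesis by auto
    qed
  next
    fix e assume "e \<in> insert {xs ! (?n - 1), xs ! 0} ?B"
    then consider "e = {xs ! (?n - 1), xs ! 0}" | i where "e = {xs ! i, xs ! Suc i}" "Suc i < ?n"
      by blast
    then show "e \<in> ?A"
    proof cases
      case 1
      with n assms show ?thesis by (auto intro!: exI[of _ "?n - 1"])
    next
      case (2 i)
      then show ?thesis by (auto intro!: exI[of _ i])
    qed
  qed
  then show ?thesis using assms by (simp add: cyc_edges_def path last_conv_nth hd_conv_nth)
qed

lemma path_edges_map_upto:
  assumes "a \<le> b"
  shows "path_edges (map g [a..b]) = (\<lambda>i. {g i, g (i + 1)}) ` {a..<b :: int}"
  using assms
proof (induction b rule: int_ge_induct)
  case (step b)
  then have "[a..b + 1] = [a..b] @ [b + 1]" by (simp add: upto_rec2)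
  moreover have "{a..<b + 1} = insert b {a..<b}" using step by auto
  moreover have "last [a..b] = b" using step by (simp add: upto_rec2)
  ultimately show ?case using step by (simp add: path_edges_append last_map)
qed simp

section \<open>The initial cycles\<close>

text \<open>An orientation of the class \<open>CX\<close> in which every vertex has exactly one
  outgoing edge. The third coordinate never changes, so each \<open>layer\<close> is closed under
  it.\<close>

definition succ_X :: "int \<Rightarrow> vtx \<Rightarrow> vtx" where
  "succ_X N v = (if special N v then vadd N v 0 1 0 else vadd N v 1 0 0)"

definition layer :: "int \<Rightarrow> int \<Rightarrow> vtx set" where
  "layer N z = {0..<N} \<times> {0..<N} \<times> {z}"

lemma init_class_colour:
  "init_class N CX = {{v, vadd N v 1 0 0} | v. v \<in> verts N \<and> \<not> special N v} \<union>
     {{v, vadd N v 0 1 0} | v. v \<in> verts N \<and> special N v}"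
  "init_class N CY = {{v, vadd N v 0 1 0} | v. v \<in> verts N \<and> \<not> special N v} \<union>
     {{v, vadd N v 0 0 1} | v. v \<in> verts N \<and> special N v}"
  "init_class N CZ = {{v, vadd N v 0 0 1} | v. v \<in> verts N \<and> \<not> special N v} \<union>
     {{v, vadd N v 1 0 0} | v. v \<in> verts N \<and> special N v}"
proof -
  have if_eq: "(CX = (if b then CZ else CX)) = (\<not> b)" "(CX = (if b then CX else CY)) = b"
    "(CX = (if b then CY else CZ)) = False" "(CY = (if b then CZ else CX)) = False"
    "(CY = (if b then CX else CY)) = (\<not> b)" "(CY = (if b then CY else CZ)) = b"
    "(CZ = (if b then CZ else CX)) = b" "(CZ = (if b then CX else CY)) = False"
    "(CZ = (if b then CY else CZ)) = (\<not> b)" for b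
    by auto
  show "init_class N CX = {{v, vadd N v 1 0 0} | v. v \<in> verts N \<and> \<not> special N v} \<union>
     {{v, vadd N v 0 1 0} | v. v \<in> verts N \<and> special N v}"
    "init_class N CY = {{v, vadd N v 0 1 0} | v. v \<in> verts N \<and> \<not> special N v} \<union>
     {{v, vadd N v 0 0 1} | v. v \<in> verts N \<and> special N v}"
    "init_class N CZ = {{v, vadd N v 0 0 1} | v. v \<in> verts N \<and> \<not> special N v} \<union>
     {{v, vadd N v 1 0 0} | v. v \<in> verts N \<and> special N v}"
    by (simp_all add: init_class_def if_eq Un_commute)
qed

lemma init_class_CX: "init_class N CX = (\<lambda>v. {v, succ_X N v}) ` verts N"
proof -
  have "(\<lambda>v. {v, succ_X N v}) ` verts N =
    (\<lambda>v. {v, vadd N v 1 0 0}) ` {v \<in> verts N. \<not> special N v} \<union>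
    (\<lambda>v. {v, vadd N v 0 1 0}) ` {v \<in> verts N. special N v}"
    by (auto simp: succ_X_def)
  then show ?thesis by (simp only: init_class_colour setcompr_eq_image)
qed

lemma mod_sum3: "(a mod N + b mod N + c mod N) mod N = (a + b + c) mod (N :: int)"
proof -
  have "(a mod N + b mod N + c mod N) mod N = ((a mod N + b mod N) mod N + c mod N) mod N"
    by (rule mod_add_left_eq[symmetric])
  then show ?thesis by (simp only: mod_add_eq)
qed

text \<open>From a vertex \<open>(x, y, z)\<close> with \<open>x + y + z = 0\<close>, \<open>succ_X\<close> runs \<open>N - 1\<close> steps in the first
  direction and then one in the second, reaching \<open>(x - 1, y + 1, z)\<close>. Hence each layer of constant
  \<open>z\<close> is a cycle. It is cut here at the two edges that merging the cube below it removes.\<close>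

lemma layer_cycle:
  assumes N: "2 < N" and x: "0 \<le> x" "x < N" and y: "0 \<le> y" "y < N"
    and z: "0 \<le> z" "z < N" and s: "(x + y + z) mod N = 0"
  obtains Q1 Q2 where "2 \<le> length Q1" "2 \<le> length Q2" "distinct Q1" "distinct Q2"
    "set Q1 \<inter> set Q2 = {}" "set Q1 \<union> set Q2 = layer N z"
    "hd Q1 = ((x + 1) mod N, y, z)" "last Q1 = (x, (y + 1) mod N, z)"
    "hd Q2 = ((x + 1) mod N, (y + 1) mod N, z)" "last Q2 = (x, y, z)"
    "path_edges Q1 \<union> path_edges Q2 \<union> {{last Q1, hd Q2}, {last Q2, hd Q1}} =
      (\<lambda>v. {v, succ_X N v}) ` layer N z"
proof -
  \<comment> \<open>For \<open>i = N * t + j\<close> with \<open>0 \<le> j < N\<close>, the vertex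
    \<open>g i\<close> lies \<open>j\<close> steps into row \<open>t\<close>, which starts at
    \<open>(x - t, y + t, z)\<close>.\<close>
  define g where "g i = ((x - i div N + i mod N) mod N, (y + i div N) mod N, z)" for i
  have g: "g (N * t + j) = ((x - t + j) mod N, (y + t) mod N, z)" if "0 \<le> j" "j < N" for t j
    using that by (simp add: g_def div_pos_pos_trivial)
  have g_Suc: "succ_X N (g i) = g (i + 1)" for i
  proof -
    define t j where "t = i div N" and "j = i mod N"
    have j: "0 \<le> j" "j < N" and i: "i = N * t + j" using N by (auto simp: t_def j_def)
    \<comment> \<open>Every row starts at a vertex of coordinate sum 0, so \<open>g i\<close> has
      sum \<open>j\<close> modulo \<open>N\<close>, and precisely the last vertex of a row is
      special.\<close>
    have "special N (g i) \<longleftrightarrow> ((x - t + j) mod N + (y + t) mod N + z) mod N = -1 mod N"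
      by (simp add: i g[OF j] special_def)
    also have "((x - t + j) mod N + (y + t) mod N + z) mod N = ((x + y + z) + j) mod N"
      using mod_sum3[of "x - t + j" N "y + t" z] z by (simp add: algebra_simps)
    also have "\<dots> = ((x + y + z) mod N + j) mod N" by (simp add: mod_simps)
    also have "\<dots> = j" using j s by simp
    finally have special: "special N (g i) \<longleftrightarrow> j = N - 1" using N by (simp add: zmod_minus1)
    show ?thesis
    proof (cases "j = N - 1")
      case True
      then have "i + 1 = N * (t + 1) + 0" by (simp add: i algebra_simps)
      then have "g (i + 1) = ((x - (t + 1)) mod N, (y + (t + 1)) mod N, z)"
        using g[of 0 "t + 1"] N by simp
      moreover have "(x - t + j) mod N = (x - (t + 1)) mod N"
      proof -
        have "x - t + j = x - (t + 1) + N" using True by simp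
        then show ?thesis by (metis mod_add_self2)
      qed
      moreover have "succ_X N (g i) = vadd N (g i) 0 1 0"
        using special True by (simp add: succ_X_def)
      ultimately show ?thesis
        by (simp add: i g[OF j] vadd_def mod_simps z) (simp add: algebra_simps)
    next
      case False
      then have "g (i + 1) = ((x - t + (j + 1)) mod N, (y + t) mod N, z)"
        using g[of "j + 1" t] j by (simp add: i add.assoc)
      moreover have "succ_X N (g i) = vadd N (g i) 1 0 0"
        using special False by (simp add: succ_X_def)
      ultimately show ?thesis
        by (simp add: i g[OF j] vadd_def mod_simps z) (simp add: algebra_simps)
    qed
  qed
  have g_0: "g 0 = (x, y, z)" using g[of 0 0] assms by simp
  have g_N2: "g (N * N) = (x, y, z)" using g[of 0 N] assms by simp
  have "layer N z \<subseteq> g ` {0..<N * N}"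
  proof
    fix v assume "v \<in> layer N z"
    then obtain a b where v: "v = (a, b, z)" "0 \<le> a" "a < N" "0 \<le> b" "b < N"
      by (auto simp: layer_def)
    \<comment> \<open>The second coordinate determines the row \<open>t\<close>, and then the first
      determines the position \<open>j\<close> in it.\<close>
    define t where "t = (b - y) mod N"
    define j where "j = (a - x + t) mod N"
    have t: "0 \<le> t" "t < N" and j: "0 \<le> j" "j < N" using N by (auto simp: t_def j_def)
    have "(x - t + j) mod N = a" "(y + t) mod N = b"
      unfolding j_def t_def using v by (simp_all add: mod_simps)
    then have "v = g (N * t + j)" using g[OF j, of t] v by simp
    moreover have "N * t + j < N * N"
    proof -
      have "N * t \<le> N * (N - 1)" using t N by (intro mult_left_mono) auto
      then show ?thesis using j by (simp add: algebra_simps)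
    qed
    moreover have "0 \<le> N * t + j" using t j N by simp
    ultimately show "v \<in> g ` {0..<N * N}" by auto
  qed
  moreover have "g ` I \<subseteq> layer N z" for I using N by (auto simp: g_def layer_def)
  ultimately have img0: "g ` {0..<N * N} = layer N z" by auto
  have "0 < N * N" using N by simp
  then have "{0..<N * N} = insert 0 {1..<N * N}" "{1..N * N} = insert (N * N) {1..<N * N}" by auto
  then have img: "g ` {1..N * N} = layer N z" using img0 g_0 g_N2 by simp
  \<comment> \<open>Injectivity comes from counting: \<open>g\<close> maps \<open>N * N\<close>
    indices onto a set of \<open>N * N\<close> vertices.\<close>
  have "card (layer N z) = card {1..N * N}"
    using N by (simp add: layer_def card_cartesian_product nat_mult_distrib)
  then have inj: "inj_on g {1..N * N}" using img by (intro eq_card_imp_inj_on) auto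
  define M where "M = N * N"
  have "3 * N \<le> N * N" using N by (intro mult_right_mono) auto
  then have NN: "N + 2 < M" unfolding M_def using N by linarith
  note g_N2 = g_N2[folded M_def] and img = img[folded M_def] and inj = inj[folded M_def]
  \<comment> \<open>The edges to be removed are the first step of row 0, from
    \<open>g M = g 0\<close> to \<open>g 1\<close>, and the second step of row 1, from
    \<open>g (N + 1)\<close> to \<open>g (N + 2)\<close>. Indexing by \<open>1..M\<close> instead of
    \<open>0..M - 1\<close> makes the former the closing edge.\<close>
  define Q1 Q2 where "Q1 = map g [1..N + 1]" and "Q2 = map g [N + 2..M]"
  have un: "{1..N + 1} \<union> {N + 2..M} = {1..M}" using NN N by auto
  have hdl: "hd [a..b] = a" "last [a..b] = b" if "a \<le> b" for a b :: int
    using that by (simp add: upto_rec1, simp add: upto_rec2)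
  have ends: "hd Q1 = g 1" "last Q1 = g (N + 1)" "hd Q2 = g (N + 2)" "last Q2 = g (M)"
    using NN N by (simp_all add: Q1_def Q2_def hd_map last_map hdl)
  have "path_edges Q1 \<union> path_edges Q2 \<union> {{last Q1, hd Q2}, {last Q2, hd Q1}} =
    (\<lambda>i. {g i, g (i + 1)}) ` ({1..<N + 1} \<union> {N + 2..<M} \<union> {N + 1, M})"
  proof -
    have "path_edges Q1 = (\<lambda>i. {g i, g (i + 1)}) ` {1..<N + 1}"
      unfolding Q1_def using N by (intro path_edges_map_upto) auto
    moreover have "path_edges Q2 = (\<lambda>i. {g i, g (i + 1)}) ` {N + 2..<M}"
      unfolding Q2_def using N NN by (intro path_edges_map_upto) auto
    moreover have "g (M + 1) = g 1" using g_Suc[of "M"] g_Suc[of 0] by (simp add: g_0 g_N2)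
    moreover have "N + 1 + 1 = N + 2" by simp
    ultimately show ?thesis by (simp only: image_Un image_insert image_empty ends)
  qed
  also have "{1..<N + 1} \<union> {N + 2..<M} \<union> {N + 1, M} = {1..M}" using NN N by auto
  also have "(\<lambda>i. {g i, g (i + 1)}) ` {1..M} = (\<lambda>v. {v, succ_X N v}) ` layer N z"
    by (simp add: img[symmetric] image_image g_Suc)
  finally have edges: "path_edges Q1 \<union> path_edges Q2 \<union> {{last Q1, hd Q2}, {last Q2, hd Q1}} =
    (\<lambda>v. {v, succ_X N v}) ` layer N z" .
  show thesis
  proof (rule that[OF _ _ _ _ _ _ _ _ _ _ edges])
    show "2 \<le> length Q1" "2 \<le> length Q2" using N NN by (simp_all add: Q1_def Q2_def)
    show "distinct Q1" "distinct Q2" using N NN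
      by (auto simp: Q1_def Q2_def distinct_map intro: inj_on_subset[OF inj])
    have "g ` {1..N + 1} \<inter> g ` {N + 2..M} = g ` ({1..N + 1} \<inter> {N + 2..M})"
      using N NN by (intro inj_on_image_Int[OF inj, symmetric]) auto
    then show "set Q1 \<inter> set Q2 = {}" by (simp add: Q1_def Q2_def)
    show "set Q1 \<union> set Q2 = layer N z"
      by (simp add: Q1_def Q2_def img[symmetric] un[symmetric] image_Un)
    show "hd Q1 = ((x + 1) mod N, y, z)" using g[of 1 0] assms ends by simp
    show "last Q1 = (x, (y + 1) mod N, z)" using g[of 1 1] assms ends by simp
    show "hd Q2 = ((x + 1) mod N, (y + 1) mod N, z)" using g[of 2 1] assms ends by (simp add: add.commute)
    show "last Q2 = (x, y, z)" using ends g_N2 by simp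
  qed
qed

section \<open>Cubes\<close>

definition cube :: "int \<Rightarrow> vtx \<Rightarrow> vtx set" where
  "cube N v = (\<lambda>(a, b, c). vadd N v a b c) ` ({0, 1} \<times> {0, 1} \<times> {0, 1})"

lemma vadd_in_cube: "a \<in> {0, 1} \<Longrightarrow> b \<in> {0, 1} \<Longrightarrow> c \<in> {0, 1} \<Longrightarrow> vadd N v a b c \<in> cube N v"
  unfolding cube_def by (rule image_eqI[of _ _ "(a, b, c)"]) auto

lemma cubeE:
  assumes "u \<in> cube N v"
  obtains a b c where "u = vadd N v a b c" "{a, b, c} \<subseteq> {0, 1}"
proof -
  have "\<exists>a b c. u = vadd N v a b c \<and> {a, b, c} \<subseteq> {0, 1}"
    using assms unfolding cube_def image_iff by (auto simp del: insert_subset)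
  then show thesis using that by blast
qed

lemma new_class_Un:
  "new_class N v CX \<union> new_class N v CY \<union> new_class N v CZ = cube_edges N v"
  unfolding new_class_def cube_edges_def old_class_def Let_def colour.case
  by (intro equalityI)
    (simp_all only: Un_insert_left Un_empty_left insert_subset empty_subsetI insert_iff simp_thms)

lemma old_class_subset: "old_class N v c \<subseteq> cube_edges N v"
  by (cases c) (auto simp: cube_edges_def)

lemma new_class_subset: "new_class N v c \<subseteq> cube_edges N v"
  by (cases c) (auto simp flip: new_class_Un)

lemma cube_edges_in_cube:
  assumes "e \<in> cube_edges N v"
  shows "e \<subseteq> cube N v" "e \<noteq> {}"
proof -
  have "\<forall>e \<in> cube_edges N v. e \<subseteq> cube N v \<and> e \<noteq> {}"
    unfolding cube_edges_def old_class_def Let_def colour.case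
    by (simp add: vadd_in_cube)
  with assms show "e \<subseteq> cube N v" "e \<noteq> {}" by auto
qed

lemma cube_edges_disjoint: "cube N v \<inter> cube N w = {} \<Longrightarrow> cube_edges N v \<inter> cube_edges N w = {}"
  using cube_edges_in_cube by blast

lemma mod_succ:
  fixes x N :: int
  assumes "0 \<le> x" "x < N"
  shows "(x + 1) mod N = (if x = N - 1 then 0 else x + 1)"
  using assms by auto

lemma new_class_disjoint:
  assumes "2 < N" "v \<in> verts N" "c \<noteq> d"
  shows "new_class N v c \<inter> new_class N v d = {}"
proof -
  obtain x y z where v: "v = (x, y, z)" by (cases v)
  define x' y' z' where "x' = (x + 1) mod N" and "y' = (y + 1) mod N" and "z' = (z + 1) mod N"
  have ne: "x \<noteq> x'" "y \<noteq> y'" "z \<noteq> z'"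
    using assms(1,2) by (auto simp: verts_def v x'_def y'_def z'_def mod_succ)
  have r: "x mod N = x" "y mod N = y" "z mod N = z" using assms(2) by (auto simp: verts_def v)
  show ?thesis using \<open>c \<noteq> d\<close> ne
    by (cases c; cases d)
      (simp_all add: new_class_def Let_def v vadd_def r x'_def[symmetric] y'_def[symmetric]
        z'_def[symmetric] doubleton_eq_iff)
qed

text \<open>These are the six corners other than \<open>000\<close> and \<open>111\<close>. Their
  coordinate sums are 0 or 1 modulo \<open>N\<close>, and neither is \<open>-1\<close> because
  \<open>N > 2\<close>.\<close>

lemma special_vadd:
  assumes "2 < N" "special N v" "a \<in> {0, 1}" "b \<in> {0, 1}" "c \<in> {0, 1}"
    "1 \<le> a + b + c" "a + b + c \<le> 2"
  shows "\<not> special N (vadd N v a b c)"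
proof -
  obtain x y z where v: "v = (x, y, z)" by (cases v)
  have "((x + a) mod N + (y + b) mod N + (z + c) mod N) mod N = ((x + y + z) mod N + (a + b + c)) mod N"
    unfolding mod_sum3 by (simp add: mod_simps) (simp add: algebra_simps)
  also have "\<dots> = (-1 + (a + b + c)) mod N"
    using assms(2) by (simp add: special_def v mod_simps)
  also have "\<dots> = a + b + c - 1" using assms by simp
  finally show ?thesis using assms by (simp add: special_def vadd_def v zmod_minus1)
qed

lemma vadd_vadd: "vadd N (vadd N v a b c) a' b' c' = vadd N v (a + a') (b + b') (c + c')"
  by (cases v) (simp add: vadd_def mod_simps add.assoc)

lemma vadd_in_verts: "0 < N \<Longrightarrow> vadd N v a b c \<in> verts N"
  by (cases v) (simp add: vadd_def verts_def)

lemma vadd_0: "v \<in> verts N \<Longrightarrow> vadd N v 0 0 0 = v"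
  by (cases v) (simp add: vadd_def verts_def)

section \<open>Edges by base vertex and direction\<close>

lemma init_class_special:
  assumes "v \<in> verts N" "special N v"
  shows "{v, vadd N v 1 0 0} \<in> init_class N CZ" "{v, vadd N v 0 1 0} \<in> init_class N CX"
    "{v, vadd N v 0 0 1} \<in> init_class N CY"
  using assms unfolding init_class_colour by blast+

lemma init_class_nonspecial:
  assumes "v \<in> verts N" "\<not> special N v"
  shows "{v, vadd N v 1 0 0} \<in> init_class N CX" "{v, vadd N v 0 1 0} \<in> init_class N CY"
    "{v, vadd N v 0 0 1} \<in> init_class N CZ"
  using assms unfolding init_class_colour by blast+

text \<open>The three cube edges leaving \<open>000\<close> follow the colouring rule for special
  vertices; the other nine start at one of the six middle corners and follow the rule for
  non-special ones.\<close>

lemma old_class_init: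
  assumes "2 < N" "v \<in> verts N" "special N v"
  shows "old_class N v c \<subseteq> init_class N c"
proof -
  define p where "p = vadd N v"
  have 0: "p 0 0 0 = v" using assms(2) by (simp add: p_def vadd_0)
  have q: "p a b c \<in> verts N \<and> \<not> special N (p a b c)"
    if "a \<in> {0, 1}" "b \<in> {0, 1}" "c \<in> {0, 1}" "1 \<le> a + b + c" "a + b + c \<le> 2" for a b c
    using assms special_vadd that by (simp add: p_def vadd_in_verts)
  have add: "vadd N (p a b c) a' b' c' = p (a + a') (b + b') (c + c')" for a b c a' b' c'
    by (simp add: p_def vadd_vadd)
  note special = init_class_special[OF assms(2,3), folded p_def]
  note nonspecial = init_class_nonspecial[of "p a b c" N for a b c, unfolded add]
  show ?thesis
    using special nonspecial[of 1 0 0] nonspecial[of 0 1 0] nonspecial[of 0 0 1]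
      nonspecial[of 1 1 0] nonspecial[of 0 1 1] nonspecial[of 1 0 1]
      q[of 1 0 0] q[of 0 1 0] q[of 0 0 1] q[of 1 1 0] q[of 0 1 1] q[of 1 0 1]
    by (cases c) (simp_all add: old_class_def Let_def 0 p_def[symmetric])
qed

text \<open>An edge has a unique base vertex and direction. If two descriptions had exchanged ends,
  two unit steps would lead from \<open>v\<close> back to \<open>v\<close>; steps in different
  directions move two coordinates, and steps in the same direction would need \<open>N\<close> to
  divide 2.\<close>

lemma edge_eqD:
  assumes N: "2 < N" and v: "v \<in> verts N" and w: "w \<in> verts N"
    and abc: "(a, b, c) \<in> {(1, 0, 0), (0, 1, 0), (0, 0, 1)}"
    and abc': "(a', b', c') \<in> {(1, 0, 0), (0, 1, 0), (0, 0, 1)}"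
    and eq: "{v, vadd N v a b c} = {w, vadd N w a' b' c'}"
  shows "v = w \<and> a = a' \<and> b = b' \<and> c = c'"
proof (cases "v = w")
  case True
  with eq have "vadd N v a b c = vadd N v a' b' c'" by (auto simp: doubleton_eq_iff)
  then show ?thesis using True v N abc abc'
    by (cases v) (auto simp: vadd_def verts_def mod_succ split: if_splits)
next
  case False
  with eq have 1: "v = vadd N w a' b' c'" "w = vadd N v a b c" by (auto simp: doubleton_eq_iff)
  then have "vadd N v (a + a') (b + b') (c + c') = v" by (metis vadd_vadd)
  moreover have "(x + 2) mod N \<noteq> x" if "0 \<le> x" "x < N" for x
  proof
    assume "(x + 2) mod N = x"
    then have "N dvd 2" using that by (metis add_diff_cancel_left' mod_eq_dvd_iff mod_pos_pos_trivial)
    then show False using N zdvd_imp_le by fastforce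
  qed
  ultimately show ?thesis using v N abc abc'
    by (cases v) (auto simp: vadd_def verts_def mod_succ split: if_splits)
qed

lemma init_classE:
  assumes "e \<in> init_class N col"
  obtains v a b c where "e = {v, vadd N v a b c}" "v \<in> verts N"
    "(a, b, c) \<in> {(1, 0, 0), (0, 1, 0), (0, 0, 1)}"
    "col = (if special N v then if a = 1 then CZ else if b = 1 then CX else CY
            else if a = 1 then CX else if b = 1 then CY else CZ)"
  using assms
  by (cases col; simp only: init_class_colour; elim UnE CollectE exE conjE)
    (erule (1) that; simp)+

text \<open>By \<open>edge_eqD\<close> an edge determines its base vertex and direction, and these
  determine its colour.\<close>

lemma init_class_disjoint:
  assumes "2 < N" "c \<noteq> d"
  shows "init_class N c \<inter> init_class N d = {}"
proof -
  have "c = d" if e: "e \<in> init_class N c" "e \<in> init_class N d" for e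
    using e(1)
  proof (rule init_classE)
    fix v a b k
    assume 1: "e = {v, vadd N v a b k}" "v \<in> verts N"
      "(a, b, k) \<in> {(1, 0, 0), (0, 1, 0), (0, 0, 1)}"
      "c = (if special N v then if a = 1 then CZ else if b = 1 then CX else CY
            else if a = 1 then CX else if b = 1 then CY else CZ)"
    show "c = d"
      using e(2)
    proof (rule init_classE)
      fix v' a' b' k'
      assume 2: "e = {v', vadd N v' a' b' k'}" "v' \<in> verts N"
        "(a', b', k') \<in> {(1, 0, 0), (0, 1, 0), (0, 0, 1)}"
        "d = (if special N v' then if a' = 1 then CZ else if b' = 1 then CX else CY
              else if a' = 1 then CX else if b' = 1 then CY else CZ)"
      have "v = v' \<and> a = a' \<and> b = b' \<and> k = k'"
        using 1 2 by (intro edge_eqD[OF assms(1) 1(2) 2(2) 1(3) 2(3)]) simp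
      then show "c = d" using 1(4) 2(4) by simp
    qed
  qed
  then show ?thesis using assms(2) by blast
qed

lemma init_class_Un:
  assumes N: "2 < N"
  shows "init_class N CX \<union> init_class N CY \<union> init_class N CZ = edges N"
proof -
  have "init_class N CX \<union> init_class N CY \<union> init_class N CZ =
    {{v, vadd N v a b c} | v a b c. v \<in> verts N \<and> (a, b, c) \<in> {(1, 0, 0), (0, 1, 0), (0, 0, 1)}}"
    unfolding init_class_def by auto blast+
  also have "\<dots> = edges N"
  proof (intro equalityI subsetI)
    fix e assume "e \<in> {{v, vadd N v a b c} | v a b c.
      v \<in> verts N \<and> (a, b, c) \<in> {(1, 0, 0), (0, 1, 0), (0, 0, 1)}}"
    then obtain v a b c where e: "e = {v, vadd N v a b c}" "v \<in> verts N"
      "(a, b, c) \<in> {(1, 0, 0), (0, 1, 0), (0, 0, 1)}" by blast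
    have "adj N v (vadd N v a b c)" using e(2,3) N vadd_in_verts[of N v a b c]
      by (cases v) (auto simp: adj_def coord_def vadd_def verts_def mod_simps)
    then show "e \<in> edges N" using e(1) unfolding edges_def by blast
  next
    fix e assume "e \<in> edges N"
    then obtain u w where e: "e = {u, w}" "adj N u w" by (auto simp: edges_def)
    have step: "b = (a + 1) mod N" if "(b - a) mod N = 1" "0 \<le> b" "b < N" for a b :: int
    proof -
      have "(b - a) mod N = 1 mod N" using that N by simp
      then have "b mod N = (1 + a) mod N" by (metis diff_add_cancel mod_add_left_eq)
      then show ?thesis using that by (simp add: add.commute)
    qed
    have "\<exists>a b c. (a, b, c) \<in> {(1, 0, 0), (0, 1, 0), (0, 0, 1)} \<and>
      (w = vadd N u a b c \<or> u = vadd N w a b c)"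
    proof -
      obtain x y z x' y' z' where uw: "u = (x, y, z)" "w = (x', y', z')" by (cases u, cases w)
      have "(w = vadd N u 1 0 0 \<or> u = vadd N w 1 0 0) \<or> (w = vadd N u 0 1 0 \<or> u = vadd N w 0 1 0) \<or>
        (w = vadd N u 0 0 1 \<or> u = vadd N w 0 0 1)"
        using e(2) by (auto simp: adj_def coord_def verts_def vadd_def uw intro: step)
      then show ?thesis by blast
    qed
    moreover have "u \<in> verts N" "w \<in> verts N" using e(2) by (auto simp: adj_def)
    ultimately show "e \<in> {{v, vadd N v a b c} | v a b c.
      v \<in> verts N \<and> (a, b, c) \<in> {(1, 0, 0), (0, 1, 0), (0, 0, 1)}}"
      using e(1) by (blast intro: insert_commute)
  qed
  finally show ?thesis .
qed

lemma cube_edges_subset_edges: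
  assumes "2 < N" "v \<in> verts N" "special N v"
  shows "cube_edges N v \<subseteq> edges N"
  unfolding init_class_Un[OF assms(1), symmetric] cube_edges_def
  using old_class_init[OF assms] by blast

text \<open>Removing all cube edges from an initial class thus amounts to removing the old edges of
  its own colour. The definition of \<open>merged\<close> uses the former, the induction over layers
  the latter.\<close>

lemma init_class_Int_cube_edges:
  assumes "2 < N" "v \<in> verts N" "special N v"
  shows "init_class N c \<inter> cube_edges N v = old_class N v c"
proof -
  have "init_class N c \<inter> old_class N v d = {}" if "c \<noteq> d" for d
    using init_class_disjoint[OF assms(1) that] old_class_init[OF assms, of d] by blast
  then show ?thesis using old_class_init[OF assms, of c]
    by (cases c) (auto simp: cube_edges_def)
qed

section \<open>Merging\<close>

text \<open>At a common vertex the two offsets differ in every coordinate, since the origins do. So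
  each coordinate of the origins differs by an odd number, \<open>N\<close> being even, and the
  coordinate sums differ by an odd number too. But both sums are \<open>-1\<close> modulo the even
  number \<open>N\<close>.\<close>

lemma cube_disjoint:
  assumes "even N" "v \<in> verts N" "w \<in> verts N" "special N v" "special N w"
    and ne: "\<forall>i\<in>{1, 2, 3}. coord v i \<noteq> coord w i"
  shows "cube N v \<inter> cube N w = {}"
proof (rule ccontr)
  assume "cube N v \<inter> cube N w \<noteq> {}"
  then obtain u where u: "u \<in> cube N v" "u \<in> cube N w" by blast
  obtain a b c where abc: "u = vadd N v a b c" "{a, b, c} \<subseteq> {0, 1}" using u(1) by (rule cubeE)
  obtain a' b' c' where abc': "u = vadd N w a' b' c'" "{a', b', c'} \<subseteq> {0, 1}"
    using u(2) by (rule cubeE)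
  obtain x y z x' y' z' where v: "v = (x, y, z)" and w: "w = (x', y', z')" by (cases v, cases w)
  have odd: "odd (p - q)"
    if "(p + d) mod N = (q + d') mod N" "{d, d'} \<subseteq> {0, 1}" "p \<noteq> q" "0 \<le> p" "p < N" "0 \<le> q" "q < N"
    for p q d d' :: int
  proof -
    have dvd: "N dvd (p + d) - (q + d')" using that(1) by (simp add: mod_eq_dvd_iff)
    have "d \<noteq> d'"
    proof
      assume "d = d'"
      with dvd have "p mod N = q mod N" by (simp add: mod_eq_dvd_iff)
      with that show False by simp
    qed
    moreover have "even ((p + d) - (q + d'))" using dvd \<open>even N\<close> by (rule dvd_trans[rotated])
    ultimately show ?thesis using that(2) by auto
  qed
  have eqs: "(x + a) mod N = (x' + a') mod N" "(y + b) mod N = (y' + b') mod N"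
    "(z + c) mod N = (z' + c') mod N"
    using abc(1) abc'(1) by (simp_all add: v w vadd_def)
  have "odd (x - x')" using eqs(1) abc(2) abc'(2) ne assms(2,3)
    by (intro odd[of x a x' a']) (simp_all add: v w verts_def coord_def)
  moreover have "odd (y - y')" using eqs(2) abc(2) abc'(2) ne assms(2,3)
    by (intro odd[of y b y' b']) (simp_all add: v w verts_def coord_def)
  moreover have "odd (z - z')" using eqs(3) abc(2) abc'(2) ne assms(2,3)
    by (intro odd[of z c z' c']) (simp_all add: v w verts_def coord_def)
  ultimately have "odd ((x + y + z) - (x' + y' + z'))" by presburger
  moreover have "N dvd (x + y + z) - (x' + y' + z')"
    using assms(4,5) by (simp add: special_def v w mod_eq_dvd_iff[symmetric])
  ultimately show False using \<open>even N\<close> dvd_trans by blast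
qed

lemma merging_set_cubes_disjoint:
  assumes "even N" "merging_set N S" "v \<in> S" "w \<in> S" "v \<noteq> w"
  shows "cube N v \<inter> cube N w = {}"
  using assms cube_disjoint[of N v w] by (auto simp: merging_set_def)

section \<open>The merged classes partition the edges\<close>

lemma merged_Un:
  assumes "2 < N" "merging_set N S"
  shows "merged N S CX \<union> merged N S CY \<union> merged N S CZ = edges N"
proof -
  have "merged N S CX \<union> merged N S CY \<union> merged N S CZ =
    (edges N - (\<Union>v\<in>S. cube_edges N v)) \<union> (\<Union>v\<in>S. cube_edges N v)"
    unfolding merged_def init_class_Un[OF assms(1), symmetric] new_class_Un[symmetric] by blast
  moreover have "(\<Union>v\<in>S. cube_edges N v) \<subseteq> edges N"
    using cube_edges_subset_edges[OF assms(1)] assms(2) by (force simp: merging_set_def)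
  ultimately show ?thesis by blast
qed

text \<open>New edges of different colours come from one cube, whose new classes are disjoint, or
  from two cubes without common vertices. A new edge is never a surviving initial edge, as all cube
  edges were removed from the initial classes.\<close>

lemma merged_disjoint:
  assumes "2 < N" "even N" "merging_set N S" "c \<noteq> d"
  shows "merged N S c \<inter> merged N S d = {}"
proof -
  have "new_class N v c \<inter> new_class N w d = {}" if "v \<in> S" "w \<in> S" for v w
  proof (cases "v = w")
    case True
    then show ?thesis using new_class_disjoint[of N v c d] assms that by (auto simp: merging_set_def)
  next
    case False
    then have "cube_edges N v \<inter> cube_edges N w = {}"
      by (intro cube_edges_disjoint merging_set_cubes_disjoint[OF assms(2,3) that])
    then show ?thesis using new_class_subset[of N v c] new_class_subset[of N w d] by blast
  qed
  then have "(\<Union>v\<in>S. new_class N v c) \<inter> (\<Union>v\<in>S. new_class N v d) = {}" by blast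
  moreover have "(\<Union>v\<in>S. new_class N v k) \<subseteq> (\<Union>v\<in>S. cube_edges N v)" for k
    using new_class_subset by blast
  moreover have "((A - C) \<union> P) \<inter> ((B - C) \<union> Q) = {}"
    if "A \<inter> B = {}" "P \<inter> Q = {}" "P \<subseteq> C" "Q \<subseteq> C" for A B C P Q :: "vtx set set"
    using that by blast
  ultimately show ?thesis
    unfolding merged_def using init_class_disjoint[OF assms(1,4)] by metis
qed

text \<open>A merging set misses exactly one value \<open>z0\<close> of the third coordinate. Starting with the layer
  above \<open>z0\<close>, the layers are joined one at a time through the cube between the last two of them:
  opening the current cycle at the edge \<open>000-010\<close> and the new layer at \<open>001-101\<close> and \<open>011-111\<close>
  leaves three paths, which the new edges of the cube connect to one cycle. Only the path from
  \<open>111\<close> to \<open>001\<close> is traversed backwards.\<close>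

theorem merged_CX_is_cycle_on:
  assumes N: "2 < N" "even N" and S: "merging_set N S"
  shows "is_cycle_on (verts N) (merged N S CX)"
proof -
  have S_verts: "v \<in> verts N" and S_special: "special N v" if "v \<in> S" for v
    using S that by (auto simp: merging_set_def)
  define zc :: "vtx \<Rightarrow> int" where "zc v = snd (snd v)" for v
  have zc_eq: "zc (x, y, z) = z" for x y z by (simp add: zc_def)
  have zc_range: "0 \<le> zc v \<and> zc v < N" if "v \<in> verts N" for v
    using that by (auto simp: zc_def verts_def)
  have inj: "inj_on zc S"
  proof (rule inj_onI, rule ccontr)
    fix v w assume vw: "v \<in> S" "w \<in> S" "zc v = zc w" "v \<noteq> w"
    then have "coord v 3 \<noteq> coord w 3" using S by (auto simp: merging_set_def)
    with vw(3) show False by (simp add: coord_def zc_def split: prod.splits)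
  qed
  have zc_S: "zc ` S \<subseteq> {0..<N}" using zc_range[OF S_verts] by auto
  have "card ({0..<N} - zc ` S) = card {0..<N} - card (zc ` S)"
    by (rule card_Diff_subset[OF finite_subset[OF zc_S] zc_S]) simp
  also have "\<dots> = 1" using S N by (simp add: card_image[OF inj] merging_set_def)
  finally obtain z0 where z0: "{0..<N} - zc ` S = {z0}" by (rule card_1_singletonE)
  then have z0_range: "0 \<le> z0" "z0 < N" by auto
  \<comment> \<open>Layers are renumbered cyclically so that the missed value \<open>z0\<close>
    becomes the last one, \<open>N - 1\<close>. Then every cube joins some layer \<open>k\<close> to
    \<open>k + 1\<close> without wrapping around.\<close>
  define Z where "Z k = (z0 + 1 + k) mod N" for k
  define off where "off v = (zc v - z0 - 1) mod N" for v
  have off_range: "0 \<le> off v \<and> off v \<le> N - 1" for v using N by (simp add: off_def)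
  have off_iff: "off v = k \<longleftrightarrow> zc v = Z k" if "v \<in> verts N" "0 \<le> k" "k < N" for v k
  proof
    assume "off v = k"
    then have "Z k = (z0 + 1 + (zc v - z0 - 1)) mod N"
      unfolding Z_def off_def by (metis mod_add_right_eq)
    then show "zc v = Z k" using zc_range[OF that(1)] by simp
  next
    assume "zc v = Z k"
    then have "off v = (z0 + 1 + k - (z0 + 1)) mod N"
      unfolding Z_def off_def by (metis diff_diff_eq mod_diff_left_eq)
    then show "off v = k" using that by simp
  qed
  have off_vadd: "off (vadd N v a b c) = (off v + c) mod N" for v a b c
    by (cases v) (simp add: off_def zc_def vadd_def mod_simps algebra_simps)
  define F where "F v = {v, succ_X N v}" for v
  \<comment> \<open>A cube reaches one layer above its origin, so the cubes in \<open>T k\<close>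
    are those lying within \<open>U k\<close>, and \<open>H k\<close> is the class \<open>CX\<close>
    on \<open>U k\<close> after merging them.\<close>
  define U where "U k = {v \<in> verts N. off v \<le> k}" for k
  define T where "T k = {v \<in> S. off v < k}" for k
  define H where "H k = (F ` U k - (\<Union>v\<in>T k. old_class N v CX)) \<union> (\<Union>v\<in>T k. new_class N v CX)"
    for k
  have layer: "layer N (Z k) = {v \<in> verts N. off v = k}" if "0 \<le> k" "k < N" for k
  proof -
    have "layer N (Z k) = {v \<in> verts N. zc v = Z k}"
      using N by (auto simp: layer_def verts_def zc_def Z_def)
    then show ?thesis using off_iff[OF _ that] by blast
  qed
  have off_succ: "succ_X N v \<in> verts N \<and> off (succ_X N v) = off v" if "v \<in> verts N" for v
    using N off_range[of v] by (simp add: succ_X_def off_vadd vadd_in_verts)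
  have F_U: "e \<subseteq> U k \<and> e \<noteq> {}" if "e \<in> F ` U k" for e k
    using that off_succ by (auto simp: F_def U_def)
  have Z_range: "0 \<le> Z k" "Z k < N" for k using N by (simp_all add: Z_def)
  have "is_cycle_on (U k) (H k)" if "0 \<le> k" "k \<le> N - 1" for k
    using that
  proof (induction k rule: int_ge_induct)
    case base
    \<comment> \<open>No cube is involved yet; any vertex of the layer with coordinate sum 0 can
      serve as the starting point.\<close>
    have sum: "((- Z 0) mod N + 0 + Z 0) mod N = 0" by (simp add: mod_simps)
    obtain Q1 Q2 where Q: "2 \<le> length Q1" "2 \<le> length Q2" "distinct Q1" "distinct Q2"
      "set Q1 \<inter> set Q2 = {}" "set Q1 \<union> set Q2 = layer N (Z 0)"
      and edges: "path_edges Q1 \<union> path_edges Q2 \<union> {{last Q1, hd Q2}, {last Q2, hd Q1}} =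
        (\<lambda>v. {v, succ_X N v}) ` layer N (Z 0)"
      by (rule layer_cycle[OF N(1) _ _ _ _ Z_range sum]) (use N in auto)
    have U: "U 0 = layer N (Z 0)"
      using layer[of 0] N off_range by (auto simp: U_def antisym)
    have "T 0 = {}" using off_range by (auto simp: T_def not_less)
    then have "H 0 = F ` layer N (Z 0)" by (simp add: H_def U)
    also have "\<dots> = cyc_edges (Q1 @ Q2)"
    proof -
      have "Q1 \<noteq> []" "Q2 \<noteq> []" using Q by auto
      then have "cyc_edges (Q1 @ Q2) =
          path_edges Q1 \<union> path_edges Q2 \<union> {{last Q1, hd Q2}, {last Q2, hd Q1}}"
        by (simp add: cyc_edges_def path_edges_append) blast
      then show ?thesis using edges by (simp add: F_def)
    qed
    finally show ?case using Q unfolding is_cycle_on_def U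
      by (intro exI[of _ "Q1 @ Q2"]) auto
  next
    case (step k)
    then have IH: "is_cycle_on (U k) (H k)" and k: "0 \<le> k" "k < N - 1" by auto
    have "Z k \<noteq> z0"
    proof
      assume "Z k = z0"
      then have "(z0 + (1 + k)) mod N = z0 mod N" using z0_range by (simp add: Z_def add.assoc)
      then have "N dvd 1 + k" by (simp add: mod_eq_dvd_iff)
      then show False using k zdvd_imp_le by fastforce
    qed
    then have "Z k \<in> zc ` S" using z0 Z_range by auto
    then obtain v where v: "v \<in> S" "zc v = Z k" by auto
    have v_off: "off v = k" using off_iff[of v k] S_verts v k by simp
    note v_verts = S_verts[OF v(1)] and v_special = S_special[OF v(1)]
    obtain x y z where xyz: "v = (x, y, z)" by (cases v)
    define p where "p = vadd N v"
    have p000: "p 0 0 0 = v" by (simp add: p_def vadd_0 v_verts)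
    have zZ: "(z + 1) mod N = Z (k + 1)"
      using v(2) by (simp add: xyz zc_eq Z_def mod_simps algebra_simps)
    \<comment> \<open>The corner \<open>001\<close> lies one above a special vertex, so its sum is 0
      and \<open>layer_cycle\<close> can start there. The ends of its two paths are then exactly the
      four upper corners of the cube.\<close>
    have sum: "(x + y + Z (k + 1)) mod N = 0"
    proof -
      have "(x + y + Z (k + 1)) mod N = ((x + y + z) mod N + 1) mod N"
        unfolding zZ[symmetric] mod_add_right_eq mod_add_left_eq by (simp add: add.assoc)
      also have "\<dots> = (-1 + 1) mod N"
        using v_special unfolding special_def xyz by (simp only: prod.case mod_add_left_eq)
      finally show ?thesis by simp
    qed
    have xy: "0 \<le> x" "x < N" "0 \<le> y" "y < N" using v_verts by (auto simp: xyz verts_def)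
    obtain Q1 Q2 where Q: "2 \<le> length Q1" "2 \<le> length Q2" "distinct Q1" "distinct Q2"
      "set Q1 \<inter> set Q2 = {}" "set Q1 \<union> set Q2 = layer N (Z (k + 1))"
      and ends: "hd Q1 = p 1 0 1" "last Q1 = p 0 1 1" "hd Q2 = p 1 1 1" "last Q2 = p 0 0 1"
      and edges: "path_edges Q1 \<union> path_edges Q2 \<union> {{last Q1, hd Q2}, {last Q2, hd Q1}} =
        F ` layer N (Z (k + 1))"
      by (rule layer_cycle[OF N(1) xy Z_range sum])
        (use xy zZ in \<open>simp add: p_def xyz vadd_def F_def\<close>)
    define L where "L = layer N (Z (k + 1))"
    have L: "L = {v \<in> verts N. off v = k + 1}" using layer[of "k + 1"] k by (simp add: L_def)
    have U: "U (k + 1) = U k \<union> L" by (auto simp: U_def L)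
    have UL: "U k \<inter> L = {}" by (auto simp: U_def L)
    have F_L: "e \<subseteq> L \<and> e \<noteq> {}" if "e \<in> F ` L" for e
      using that off_succ by (auto simp: F_def L)
    have T: "T (k + 1) = insert v (T k)"
    proof -
      have "w = v" if "w \<in> S" "off w = k" for w
        using off_iff[OF S_verts[OF that(1)] k(1)] that k v by (intro inj_onD[OF inj]) auto
      then have "{w \<in> S. off w = k} = {v}" using v(1) v_off by blast
      moreover have "T (k + 1) = {w \<in> S. off w = k} \<union> T k" by (auto simp: T_def)
      ultimately show ?thesis by simp
    qed
    have v_T: "v \<notin> T k" using v_off by (simp add: T_def)

    define e0 e1 e2 e3 n0 n2 n3 where es: "e0 = {p 0 0 0, p 0 1 0}" "e1 = {p 0 1 0, p 1 1 0}"
      "e2 = {p 0 0 1, p 1 0 1}" "e3 = {p 0 1 1, p 1 1 1}" "n0 = {p 0 0 0, p 0 0 1}"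
      "n2 = {p 0 1 0, p 0 1 1}" "n3 = {p 1 0 1, p 1 1 1}"
    have old: "old_class N v CX = {e0, e1, e2, e3}"
      by (simp add: old_class_def es p_def Let_def)
    have new: "new_class N v CX = {n0, e1, n2, n3}"
      by (simp add: new_class_def es p_def Let_def)
    have e_cube: "e0 \<in> cube_edges N v" "e1 \<in> cube_edges N v"
      using old old_class_subset[of N v CX] by auto
    \<comment> \<open>Earlier merges used cubes disjoint from the one at \<open>v\<close>, so
      \<open>e0\<close> and \<open>e1\<close> are still initial edges present in
      \<open>H k\<close>.\<close>
    have other: "e0 \<notin> cube_edges N w \<and> e1 \<notin> cube_edges N w" if "w \<in> T k" for w
    proof -
      have "w \<in> S" "w \<noteq> v" using that v_T by (auto simp: T_def)
      then have "cube_edges N w \<inter> cube_edges N v = {}"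
        by (intro cube_edges_disjoint merging_set_cubes_disjoint[OF N(2) S _ v(1)])
      with e_cube show ?thesis by blast
    qed
    have cube_U: "cube N w \<subseteq> U k" if "w \<in> T k" for w
    proof -
      have "off w < k" using that by (simp add: T_def)
      then have "(off w + c) mod N \<le> k" if "c \<in> {0, 1}" for c
        using that off_range[of w] k by auto
      then show ?thesis using N
        by (intro subsetI, elim cubeE) (simp add: U_def off_vadd vadd_in_verts)
    qed
    define Old Nw where "Old = (\<Union>w\<in>T k. old_class N w CX)" and "Nw = (\<Union>w\<in>T k. new_class N w CX)"
    have O_U: "e \<subseteq> U k \<and> e \<noteq> {}" if "e \<in> Old" for e
      using that cube_U cube_edges_in_cube[of e N] old_class_subset[of N _ CX]
      unfolding Old_def by blast
    have Nw_U: "e \<subseteq> U k \<and> e \<noteq> {}" if "e \<in> Nw" for e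
      using that cube_U cube_edges_in_cube[of e N] new_class_subset[of N _ CX]
      unfolding Nw_def by blast
    have e01: "e0 \<notin> Old" "e0 \<notin> Nw" "e1 \<notin> Old"
      using other old_class_subset[of N _ CX] new_class_subset[of N _ CX]
      unfolding Old_def Nw_def by blast+
    have p_U: "v \<in> U k" "p 0 1 0 \<in> U k"
      using v_off v_verts k N by (auto simp: U_def p_def off_vadd vadd_in_verts)
    have "succ_X N v = p 0 1 0" using v_special by (simp add: succ_X_def p_def)
    then have "e0 = F v" by (simp add: F_def es p000)
    then have e0: "e0 \<in> F ` U k" using p_U by blast
    have "\<not> special N (p 0 1 0)" using special_vadd[OF N(1) v_special] by (simp add: p_def)
    then have "succ_X N (p 0 1 0) = p 1 1 0" by (simp add: succ_X_def p_def vadd_vadd)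
    then have "e1 = F (p 0 1 0)" by (simp add: F_def es)
    then have e1: "e1 \<in> F ` U k" using p_U by blast
    have "p 1 1 0 \<noteq> p 0 0 0" using N xy by (simp add: p_def xyz vadd_def mod_succ)
    then have e01_ne: "e0 \<noteq> e1" by (auto simp: es doubleton_eq_iff)
    have H: "H k = (F ` U k - Old) \<union> Nw" by (simp add: H_def Old_def Nw_def)
    have H_U: "e \<subseteq> U k" if "e \<in> H k" for e using that F_U[of e k] Nw_U unfolding H by blast
    have e0_H: "e0 \<in> H k" and e1_H: "e1 \<in> H k" using e0 e1 e01 by (auto simp: H)

    obtain P where P: "distinct P" "3 \<le> length P" "set P = U k" "path_edges P = H k - {e0}"
      "hd P = p 0 1 0" "last P = p 0 0 0"
      using is_cycle_on_cut[OF IH, of "p 0 1 0" "p 0 0 0"] e0_H by (auto simp: es insert_commute)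
    have Q_ne: "Q1 \<noteq> []" "Q2 \<noteq> []" using Q by auto
    have "set P \<inter> set Q1 = {}" "set P \<inter> set Q2 = {}"
      using UL Q(6) unfolding P(3) L_def[symmetric] by blast+
    from is_cycle_on_merge[OF P(1,2) Q(3,4) Q_ne this Q(5)]
    have cyc: "is_cycle_on (U k \<union> set Q1 \<union> set Q2)
      ((H k - {e0}) \<union> path_edges Q1 \<union> path_edges Q2 \<union> {n0, n2, n3})"
      unfolding P ends es by (simp add: insert_commute)
    \<comment> \<open>Both edges run between the disjoint vertex sets of \<open>Q1\<close> and
      \<open>Q2\<close>, so neither path contains them.\<close>
    have "e2 \<notin> path_edges Q1" "e2 \<notin> path_edges Q2" "e3 \<notin> path_edges Q1" "e3 \<notin> path_edges Q2"
      using path_edges_subset[of _ Q1] path_edges_subset[of _ Q2] Q(5) hd_in_set[OF Q_ne(1)]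
        hd_in_set[OF Q_ne(2)] last_in_set[OF Q_ne(1)] last_in_set[OF Q_ne(2)]
      unfolding ends es by blast+
    moreover have Q_edges: "path_edges Q1 \<union> path_edges Q2 \<union> {e2, e3} = F ` L"
      using edges unfolding ends es L_def by (simp add: insert_commute)
    ultimately have paths: "path_edges Q1 \<union> path_edges Q2 = F ` L - {e2, e3}"
      unfolding Q_edges[symmetric] by blast
    have "e \<notin> H k" if "e \<in> F ` L" for e using H_U[of e] F_L[OF that] UL by blast
    moreover have "e2 \<in> F ` L" "e3 \<in> F ` L" unfolding Q_edges[symmetric] by simp_all
    ultimately have e23: "e2 \<notin> H k" "e3 \<notin> H k" by simp_all
    have LO: "F ` L \<inter> Old = {}" using F_L O_U UL by blast
    have e01_L: "e0 \<notin> F ` L" using F_U[OF e0] F_L UL by blast+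
    \<comment> \<open>The edge \<open>e1\<close>, here \<open>a1\<close>, is in both the old and the
      new class of the cube. It is removed and put back, so the exchange really replaces three
      edges: \<open>a0\<close> from the part built so far, \<open>a2\<close> and \<open>a3\<close>
      from the new layer.\<close>
    have set_eq: "((A \<union> B) - (C \<union> {a0, a1, a2, a3})) \<union> (M \<union> {b0, a1, b2, b3}) =
        (K - {a0}) \<union> (B - {a2, a3}) \<union> {b0, b2, b3}"
      if "K = (A - C) \<union> M" "a2 \<notin> K" "a3 \<notin> K" "B \<inter> C = {}" "a0 \<notin> B" "a0 \<notin> M" "a0 \<noteq> a1" "a1 \<in> K"
      for A B C K M and a0 a1 a2 a3 b0 b2 b3 :: "vtx set"
      using that by blast
    have "H (k + 1) = ((F ` U k \<union> F ` L) - (Old \<union> {e0, e1, e2, e3})) \<union> (Nw \<union> {n0, e1, n2, n3})"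
      by (simp only: H_def T U image_Un UN_insert old new Old_def Nw_def Un_ac)
    also have "\<dots> = (H k - {e0}) \<union> (F ` L - {e2, e3}) \<union> {n0, n2, n3}"
      by (rule set_eq[OF H e23 LO _ e01(2) e01_ne e1_H]) (fact e01_L)
    also have "\<dots> = (H k - {e0}) \<union> path_edges Q1 \<union> path_edges Q2 \<union> {n0, n2, n3}"
      unfolding paths[symmetric] by blast
    finally have "is_cycle_on (U k \<union> set Q1 \<union> set Q2) (H (k + 1))" using cyc by simp
    moreover have "U (k + 1) = U k \<union> set Q1 \<union> set Q2" using U Q(6) L_def by blast
    ultimately show ?case by simp
  qed
  then have "is_cycle_on (U (N - 1)) (H (N - 1))" using N by simp
  moreover have "U (N - 1) = verts N" using off_range by (auto simp: U_def)
  moreover have "T (N - 1) = S"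
  proof -
    have "off v \<noteq> N - 1" if "v \<in> S" for v
    proof -
      have "Z (N - 1) = (z0 + N) mod N" by (simp add: Z_def)
      then have "Z (N - 1) = z0" using z0_range by simp
      moreover have "zc v \<noteq> z0" using z0 that by auto
      ultimately show ?thesis using off_iff[of v "N - 1"] S_verts[OF that] N by simp
    qed
    then have "off v < N - 1" if "v \<in> S" for v using that off_range[of v] by fastforce
    then show ?thesis unfolding T_def by blast
  qed
  moreover have "F ` verts N = init_class N CX" by (simp add: init_class_CX F_def)
  moreover have "init_class N CX - (\<Union>v\<in>S. old_class N v CX) =
    init_class N CX - (\<Union>v\<in>S. cube_edges N v)"
    using init_class_Int_cube_edges[OF N(1) S_verts S_special, of _ CX] by blast
  ultimately show ?thesis by (simp add: H_def merged_def)
qed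

section \<open>The rotation of the coordinates\<close>

definition rot :: "vtx \<Rightarrow> vtx" where
  "rot v = (case v of (x, y, z) \<Rightarrow> (z, x, y))"

fun next_colour :: "colour \<Rightarrow> colour" where
  "next_colour CX = CY"
| "next_colour CY = CZ"
| "next_colour CZ = CX"

lemma bij_rot: "bij rot"
  by (rule bij_betw_byWitness[of _ "rot \<circ> rot"]) (auto simp: rot_def)

lemma rot_in_verts_iff: "rot v \<in> verts N \<longleftrightarrow> v \<in> verts N"
  by (cases v) (auto simp: rot_def verts_def)

lemma special_rot: "special N (rot v) \<longleftrightarrow> special N v"
  by (cases v) (simp add: rot_def special_def algebra_simps)

lemma rot_vadd: "rot (vadd N v a b c) = vadd N (rot v) c a b"
  by (cases v) (simp add: rot_def vadd_def)

lemma rot_image_Collect: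
  assumes "\<And>v. P (rot v) = P v"
  shows "rot ` Collect P = Collect P"
proof (intro equalityI subsetI)
  fix w assume "w \<in> Collect P"
  moreover obtain v where "w = rot v" using bij_is_surj[OF bij_rot] by (rule surjE)
  ultimately show "w \<in> rot ` Collect P" using assms by simp
qed (use assms in auto)

lemma adj_rot: "adj N u v \<Longrightarrow> adj N (rot u) (rot v)"
  by (cases u; cases v) (auto simp: adj_def coord_def rot_def verts_def)

text \<open>Numbering the classes and directions cyclically, class \<open>i\<close> takes direction
  \<open>i\<close> at non-special vertices and direction \<open>i + 1\<close> at special ones. The
  map \<open>rot\<close> shifts directions by one and preserves speciality.\<close>

lemma init_class_rot: "(`) rot ` init_class N c = init_class N (next_colour c)"
proof -
  have R: "(`) rot ` {{v, vadd N v a b d} | v. v \<in> verts N \<and> P v} =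
      {{v, vadd N v d a b} | v. v \<in> verts N \<and> P v}" if "\<And>v. P (rot v) = P v" for a b d P
  proof -
    have "(`) rot ` {{v, vadd N v a b d} | v. v \<in> verts N \<and> P v} =
      (\<lambda>v. {v, vadd N v d a b}) ` rot ` {v. v \<in> verts N \<and> P v}"
      by (simp only: setcompr_eq_image image_image image_insert image_empty rot_vadd)
    also have "rot ` {v. v \<in> verts N \<and> P v} = {v. v \<in> verts N \<and> P v}"
      using that by (intro rot_image_Collect) (simp add: rot_in_verts_iff)
    finally show ?thesis by (simp only: setcompr_eq_image)
  qed
  show ?thesis
    by (cases c) (simp_all only: init_class_colour next_colour.simps image_Un R special_rot)
qed

lemma old_class_rot: "(`) rot ` old_class N v c = old_class N (rot v) (next_colour c)"
  by (cases c) (simp_all add: old_class_def Let_def rot_vadd insert_commute)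

lemma new_class_rot: "(`) rot ` new_class N v c = new_class N (rot v) (next_colour c)"
  by (cases c) (simp_all add: new_class_def Let_def rot_vadd insert_commute)

lemma cube_edges_rot: "(`) rot ` cube_edges N v = cube_edges N (rot v)"
  by (simp add: cube_edges_def image_Un old_class_rot Un_ac)

lemma merged_rot:
  assumes "rot ` S = S"
  shows "(`) rot ` merged N S c = merged N S (next_colour c)"
proof -
  have "inj ((`) rot)"
    by (rule injI) (simp add: inj_image_eq_iff bij_is_inj[OF bij_rot])
  moreover have "(\<Union>v\<in>S. f (rot v)) = (\<Union>v\<in>S. f v)" for f :: "vtx \<Rightarrow> vtx set set"
    using arg_cong[OF assms, of "\<lambda>A. \<Union>(f ` A)"] by (simp only: image_image)
  note this[of "cube_edges N"] this[of "\<lambda>v. new_class N v (next_colour c)"]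
  ultimately show ?thesis
    by (simp add: merged_def image_Un image_set_diff image_UN init_class_rot cube_edges_rot
        new_class_rot)
qed

text \<open>Besides being an automorphism, \<open>rot\<close> fixes the origin, so the image cycle
  starts there as well.\<close>

lemma dir_ham_cycle_rot: "dir_ham_cycle N f \<Longrightarrow> dir_ham_cycle N (rot \<circ> f)"
proof -
  assume f: "dir_ham_cycle N f"
  have "rot ` verts N = verts N"
    using rot_image_Collect[of "\<lambda>v. v \<in> verts N"] by (simp add: rot_in_verts_iff)
  then have "bij_betw rot (verts N) (verts N)"
    using bij_rot by (simp add: bij_betw_def inj_on_subset[OF bij_is_inj])
  then show ?thesis using f adj_rot
    by (auto simp: dir_ham_cycle_def rot_def intro: bij_betw_trans)
qed

lemma cycle_edges_rot: "cycle_edges N (rot \<circ> f) = (`) rot ` cycle_edges N f"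
  by (simp add: cycle_edges_def setcompr_eq_image image_image)

text \<open>The action uses inverse permutations, and rows 2 and 3 of \<open>srcM\<close> are
  inverse to each other, so each of them acts through the entries of the other.\<close>

lemma perm_act_srcM:
  "perm_act (row_perm srcM 1) = id"
  "perm_act (row_perm srcM 2) = rot"
  "perm_act (row_perm srcM 3) = rot \<circ> rot"
proof -
  have M: "srcM 1 1 = 1" "srcM 1 2 = 2" "srcM 1 3 = 3" "srcM 2 1 = 2" "srcM 2 2 = 3" "srcM 2 3 = 1"
    "srcM 3 1 = 3" "srcM 3 2 = 1" "srcM 3 3 = 2"
    by (simp_all add: srcM_def)
  have 1: "row_perm srcM 1 = id" by (rule ext) (auto simp: row_perm_def M simp del: One_nat_def)
  have 2: "row_perm srcM 2 = (\<lambda>j. if j = 1 then 2 else if j = 2 then 3 else if j = 3 then 1 else j)"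
    by (rule ext) (auto simp: row_perm_def M simp del: One_nat_def)
  have 3: "row_perm srcM 3 = (\<lambda>j. if j = 1 then 3 else if j = 2 then 1 else if j = 3 then 2 else j)"
    by (rule ext) (auto simp: row_perm_def M simp del: One_nat_def)
  have i2: "inv (row_perm srcM 2) = row_perm srcM 3" by (rule inv_equality) (auto simp: 2 3)
  have i3: "inv (row_perm srcM 3) = row_perm srcM 2" by (rule inv_equality) (auto simp: 2 3)
  show "perm_act (row_perm srcM 1) = id"
    unfolding perm_act_def 1 inv_id by (rule ext) (simp add: coord_def split: prod.splits)
  show "perm_act (row_perm srcM 2) = rot"
    unfolding perm_act_def i2 3 by (rule ext) (simp add: coord_def rot_def split: prod.splits)
  show "perm_act (row_perm srcM 3) = rot \<circ> rot"
    unfolding perm_act_def i3 2 by (rule ext) (simp add: coord_def rot_def split: prod.splits)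
qed

lemma latin3_srcM: "latin3 srcM"
proof -
  have M: "srcM 1 1 = 1" "srcM 1 2 = 2" "srcM 1 3 = 3" "srcM 2 1 = 2" "srcM 2 2 = 3" "srcM 2 3 = 1"
    "srcM 3 1 = 3" "srcM 3 2 = 1" "srcM 3 3 = 2"
    by (simp_all add: srcM_def)
  show ?thesis
    by (auto simp: latin3_def bij_betw_def inj_on_def M simp del: One_nat_def)
qed

section \<open>The merging set\<close>

text \<open>Since \<open>4 * 4 = 16\<close> is congruent to 4 modulo 6, so is every positive power
  of 4. This makes all divisions in \<open>S_star\<close> exact.\<close>

lemma four_power_eq:
  assumes "n \<ge> 1"
  obtains m :: int where "0 \<le> m" "(4 :: int) ^ n = 6 * m + 4"
proof -
  have "\<exists>m\<ge>0. (4 :: int) ^ n = 6 * m + 4" using assms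
  proof (induction n rule: nat_induct_at_least)
    case base
    show ?case by (intro exI[of _ 0]) simp
  next
    case (Suc n)
    then obtain m :: int where "0 \<le> m" "(4 :: int) ^ n = 6 * m + 4" by blast
    then show ?case by (intro exI[of _ "4 * m + 2"]) simp
  qed
  then show thesis using that by blast
qed

text \<open>In the given ranges of \<open>k\<close> all entries already lie between 0 and
  \<open>N - 1\<close>, so the reductions modulo \<open>N\<close> disappear. Expressing
  \<open>k\<close> by the first coordinate leaves conditions for linear arithmetic.\<close>

lemma S_star_iff:
  assumes "(4 :: int) ^ n = 6 * m + 4" "0 \<le> m"
  shows "(x, y, z) \<in> S_star n \<longleftrightarrow>
    (0 \<le> x \<and> x \<le> m \<and> y = 3 * m + 1 - 2 * x \<and> z = 3 * m + 2 + x) \<or>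
    (4 * m + 3 \<le> x \<and> x \<le> 5 * m + 2 \<and> y = x + m + 1 \<and> z = 11 * m + 6 - 2 * x)"
proof -
  have div: "(6 * m + 4 - 4) div 6 = m" "(6 * m + 4) div 2 = 3 * m + 2"
    "(4 * (6 * m + 4) + 2) div 6 = 4 * m + 3" "(5 * (6 * m + 4) + 4) div 6 = 5 * m + 4"
    by presburger+
  have A: "(k mod (6 * m + 4), (3 * m + 2 - 1 - 2 * k) mod (6 * m + 4), (3 * m + 2 + k) mod (6 * m + 4)) =
      (k, 3 * m + 1 - 2 * k, 3 * m + 2 + k)" if "0 \<le> k" "k \<le> m" for k
    using that by simp
  have B: "((4 * m + 3 + k) mod (6 * m + 4), (5 * m + 4 + k) mod (6 * m + 4),
        (3 * m + 2 - 2 - 2 * k) mod (6 * m + 4)) = (4 * m + 3 + k, 5 * m + 4 + k, 3 * m - 2 * k)"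
    if "0 \<le> k" "k \<le> m - 1" for k
    using that by simp
  have "S_star n = {(k, 3 * m + 1 - 2 * k, 3 * m + 2 + k) | k. 0 \<le> k \<and> k \<le> m} \<union>
      {(4 * m + 3 + k, 5 * m + 4 + k, 3 * m - 2 * k) | k. 0 \<le> k \<and> k \<le> m - 1}"
    unfolding S_star_def assms(1) Let_def div using A B
    by (intro arg_cong2[of _ _ _ _ "(\<union>)"]) (metis (no_types, lifting))+
  moreover have "(x, y, z) \<in> {(4 * m + 3 + k, 5 * m + 4 + k, 3 * m - 2 * k) | k. 0 \<le> k \<and> k \<le> m - 1} \<longleftrightarrow>
    4 * m + 3 \<le> x \<and> x \<le> 5 * m + 2 \<and> y = x + m + 1 \<and> z = 11 * m + 6 - 2 * x"
    by (auto intro!: exI[of _ "x - 4 * m - 3"])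
  ultimately show ?thesis by auto
qed

lemma S_set_rot: "rot ` S_set n = S_set n"
proof -
  have "S_set n = {v. v \<in> S_set n}" by simp
  moreover have "rot v \<in> S_set n \<longleftrightarrow> v \<in> S_set n" for v
    by (cases v) (auto simp: S_set_def rot_def)
  ultimately show ?thesis using rot_image_Collect[of "\<lambda>v. v \<in> S_set n"] by simp
qed

text \<open>The three coordinates of the first progression run over \<open>0..m\<close>, the numbers
  in \<open>m + 1..3 * m + 1\<close> with the parity of \<open>3 * m + 1\<close>, and
  \<open>3 * m + 2..4 * m + 2\<close>. Those of the second run over
  \<open>4 * m + 3..5 * m + 2\<close>, \<open>5 * m + 4..6 * m + 3\<close>, and the remaining
  numbers in \<open>m + 1..3 * m + 1\<close>. These six ranges are disjoint and miss only
  \<open>5 * m + 3\<close>, which gives both the cardinality and the distinctness of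
  coordinates.\<close>

lemma merging_set_S_set:
  assumes "n \<ge> 1"
  shows "merging_set (4 ^ n) (S_set n)"
proof -
  obtain m where m: "0 \<le> m" and N: "(4 :: int) ^ n = 6 * m + 4" using four_power_eq[OF assms] .
  note star = S_star_iff[OF N m]
  have set: "(x, y, z) \<in> S_set n \<longleftrightarrow>
      (x, y, z) \<in> S_star n \<or> (y, z, x) \<in> S_star n \<or> (z, x, y) \<in> S_star n" for x y z
    by (simp add: S_set_def)
  have range: "0 \<le> x \<and> x < 6 * m + 4 \<and> x \<noteq> 5 * m + 3" if "(x, y, z) \<in> S_set n" for x y z
    using that m unfolding set star by presburger
  have rotate: "(y, z, x) \<in> S_set n" "(z, x, y) \<in> S_set n" if "(x, y, z) \<in> S_set n" for x y z
    using that unfolding set by blast+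
  txt \<open>The last two coordinates of a point of \<open>S_set n\<close> as functions of the first; the first
    coordinate takes every value except \<open>5 * m + 3\<close>.\<close>
  define \<phi> where "\<phi> = (\<lambda>x. if x \<le> m then (3 * m + 1 - 2 * x, 3 * m + 2 + x)
    else if x \<le> 3 * m + 1 then
      if even (3 * m + 1 - x) then (3 * m + 2 + (3 * m + 1 - x) div 2, (3 * m + 1 - x) div 2)
      else (4 * m + 3 + (3 * m - x) div 2, 5 * m + 4 + (3 * m - x) div 2)
    else if x \<le> 4 * m + 2 then (x - 3 * m - 2, 9 * m + 5 - 2 * x)
    else if x \<le> 5 * m + 2 then (x + m + 1, 11 * m + 6 - 2 * x)
    else (13 * m + 8 - 2 * x, x - m - 1))"
  have "\<phi> x = (y, z)" if "(x, y, z) \<in> S_set n" for x y z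
    using that unfolding set star by (elim disjE conjE) (use m in \<open>simp_all add: \<phi>_def\<close>)
  then have determined: "y = y' \<and> z = z'" if "(x, y, z) \<in> S_set n" "(x, y', z') \<in> S_set n"
    for x y z y' z'
    using that by (metis prod.inject)
  have surj: "\<exists>y z. (x, y, z) \<in> S_set n" if "0 \<le> x" "x < 6 * m + 4" "x \<noteq> 5 * m + 3" for x
  proof -
    have "x \<le> m \<or> m < x" "x \<le> 3 * m + 1 \<or> 3 * m + 2 \<le> x" "x \<le> 4 * m + 2 \<or> 4 * m + 3 \<le> x"
      "x \<le> 5 * m + 2 \<or> 5 * m + 4 \<le> x" using that(3) by auto
    then consider "x \<le> m" | "m < x" "x \<le> 3 * m + 1" "even (3 * m + 1 - x)"
      | "m < x" "x \<le> 3 * m + 1" "odd (3 * m + 1 - x)" | "3 * m + 2 \<le> x" "x \<le> 4 * m + 2"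
      | "4 * m + 3 \<le> x" "x \<le> 5 * m + 2" | "5 * m + 4 \<le> x" by blast
    then show ?thesis
    proof cases
      case 1
      then show ?thesis using that m unfolding set star by auto
    next
      case 2
      from 2(3) obtain k where "3 * m + 1 - x = 2 * k" by (rule evenE)
      then have "(k, x, 3 * m + 2 + k) \<in> S_star n" using 2 m unfolding star by simp
      then show ?thesis unfolding set by blast
    next
      case 3
      from 3(3) obtain k where "3 * m + 1 - x = 2 * k + 1" by (rule oddE)
      then have "(4 * m + 3 + k, 5 * m + 4 + k, x) \<in> S_star n" using 3 m unfolding star by simp
      then show ?thesis unfolding set by blast
    next
      case 4
      then have "(x - 3 * m - 2, 9 * m + 5 - 2 * x, x) \<in> S_star n" using m unfolding star by simp
      then show ?thesis unfolding set by blast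
    next
      case 5
      then have "(x, x + m + 1, 11 * m + 6 - 2 * x) \<in> S_star n" using m unfolding star by simp
      then show ?thesis unfolding set by blast
    next
      case 6
      then have "(x - m - 1, x, 13 * m + 8 - 2 * x) \<in> S_star n" using that m unfolding star by simp
      then show ?thesis unfolding set by blast
    qed
  qed
  have "fst ` S_set n = {0..<6 * m + 4} - {5 * m + 3}"
  proof (intro equalityI subsetI)
    fix x assume "x \<in> fst ` S_set n"
    then obtain y z where "(x, y, z) \<in> S_set n" by (metis imageE prod.collapse)
    then show "x \<in> {0..<6 * m + 4} - {5 * m + 3}" using range by simp
  next
    fix x assume "x \<in> {0..<6 * m + 4} - {5 * m + 3}"
    then obtain y z where "(x, y, z) \<in> S_set n" using surj[of x] by auto
    then show "x \<in> fst ` S_set n" by (metis fst_conv image_eqI)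
  qed
  moreover have "inj_on fst (S_set n)" using determined by (auto simp: inj_on_def)
  ultimately have "card (S_set n) = card ({0..<6 * m + 4} - {5 * m + 3})"
    by (metis card_image)
  also have "\<dots> = nat (6 * m + 4 - 1)" using m by (simp add: nat_diff_distrib)
  finally have card: "card (S_set n) = nat (4 ^ n - 1)" by (simp add: N)
  have verts: "S_set n \<subseteq> verts (4 ^ n)"
  proof
    fix v assume v: "v \<in> S_set n"
    obtain x y z where xyz: "v = (x, y, z)" by (cases v)
    show "v \<in> verts (4 ^ n)"
      using range[OF v[unfolded xyz]] range[OF rotate(1)[OF v[unfolded xyz]]]
        range[OF rotate(2)[OF v[unfolded xyz]]]
      by (simp add: xyz verts_def N)
  qed
  have "special (4 ^ n) v" if "v \<in> S_set n" for v
  proof -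
    obtain x y z where v: "v = (x, y, z)" by (cases v)
    \<comment> \<open>Points from the first progression have sum \<open>N - 1\<close>, those from
      the second \<open>2 * N - 1\<close>.\<close>
    have "x + y + z = 6 * m + 3 \<or> x + y + z = 12 * m + 7"
      using that m unfolding v set star by presburger
    then have "(x + y + z) - (-1) = 1 * (6 * m + 4) \<or> (x + y + z) - (-1) = 2 * (6 * m + 4)" by presburger
    then show ?thesis unfolding special_def v N prod.case mod_eq_dvd_iff by (metis dvd_triv_right)
  qed
  moreover have "coord v i \<noteq> coord w i" if "v \<in> S_set n" "w \<in> S_set n" "v \<noteq> w" "i \<in> {1, 2, 3}" for v w i
  proof
    assume eq: "coord v i = coord w i"
    obtain x y z x' y' z' where vw: "v = (x, y, z)" "w = (x', y', z')" by (cases v, cases w)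
    from eq \<open>i \<in> {1, 2, 3}\<close> consider "x = x'" | "y = y'" | "z = z'"
      by (auto simp: coord_def vw)
    \<comment> \<open>Rotating both points brings the common coordinate to the front, where
      \<open>determined\<close> applies.\<close>
    then have "v = w"
      using that(1,2) unfolding vw by cases (blast dest: determined rotate)+
    with \<open>v \<noteq> w\<close> show False by contradiction
  qed
  ultimately show ?thesis using card verts by (simp add: merging_set_def)
qed

section \<open>The Latin decomposition\<close>

lemma card_verts: "0 \<le> N \<Longrightarrow> card (verts N) = nat (N ^ 3)"
proof -
  assume "0 \<le> N"
  moreover have "verts N = {0..<N} \<times> {0..<N} \<times> {0..<N}" by (auto simp: verts_def)
  ultimately show ?thesis by (simp add: card_cartesian_product power3_eq_cube nat_mult_distrib mult.assoc)
qed

lemma edges_adj: "{u, v} \<in> edges N \<Longrightarrow> adj N u v"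
proof -
  have "adj N v u" if "adj N u v" for u v using that unfolding adj_def by metis
  then show "{u, v} \<in> edges N \<Longrightarrow> adj N u v" by (auto simp: edges_def doubleton_eq_iff)
qed

text \<open>The list is turned to begin at the origin; its length is \<open>N ^ 3\<close> by
  counting vertices, and consecutive entries are adjacent because \<open>H\<close> consists of edges
  of the graph.\<close>

lemma is_cycle_on_dir_ham_cycle:
  assumes "is_cycle_on (verts N) H" "H \<subseteq> edges N" "0 < N"
  obtains f where "dir_ham_cycle N f" "cycle_edges N f = H"
proof -
  have "(0, 0, 0) \<in> verts N" using assms(3) by (simp add: verts_def)
  then obtain xs where xs: "distinct xs" "3 \<le> length xs" "set xs = verts N" "cyc_edges xs = H"
    "hd xs = (0, 0, 0)"
    using is_cycle_on_start[OF assms(1)] by metis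
  have len: "nat (N ^ 3) = length xs"
    using card_verts[of N] distinct_card[OF xs(1)] assms(3) xs(3) by simp
  have "xs \<noteq> []" using xs(2) by auto
  then have H: "cycle_edges N ((!) xs) = H"
    using xs(4) by (simp add: cycle_edges_def len cyc_edges_nth)
  have "bij_betw ((!) xs) {..<nat (N ^ 3)} (verts N)"
    by (rule bij_betw_nth) (simp_all add: len xs)
  moreover have "xs ! 0 = (0, 0, 0)" using xs(5) \<open>xs \<noteq> []\<close> by (simp add: hd_conv_nth)
  moreover have "adj N (xs ! i) (xs ! (Suc i mod nat (N ^ 3)))" if "i < nat (N ^ 3)" for i
  proof -
    have "{xs ! i, xs ! (Suc i mod nat (N ^ 3))} \<in> cycle_edges N ((!) xs)"
      using that unfolding cycle_edges_def by blast
    then show ?thesis using H assms(2) edges_adj by blast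
  qed
  ultimately have "dir_ham_cycle N ((!) xs)" by (simp add: dir_ham_cycle_def)
  with H show thesis using that by blast
qed

theorem theorem1:
  fixes n :: nat
  assumes "n \<ge> 1"
  shows "let N = (4::int) ^ n; S = S_set n;
             X = merged N S CX; Y = merged N S CY; Z = merged N S CZ in
           merging_set N S \<and>
           ham_cycle_edges N X \<and> ham_cycle_edges N Y \<and> ham_cycle_edges N Z \<and>
           X \<inter> Y = {} \<and> Y \<inter> Z = {} \<and> X \<inter> Z = {} \<and> X \<union> Y \<union> Z = edges N \<and>
           edge_img (row_perm srcM 2) X = Y \<and> edge_img (row_perm srcM 3) X = Z \<and>
           (\<exists>f. cycle_edges N f = X \<and> source_cycle N srcM f)"
proof -
  define N where "N = (4::int) ^ n"
  define S where "S = S_set n"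
  define X Y Z where "X = merged N S CX" and "Y = merged N S CY" and "Z = merged N S CZ"
  obtain m where "0 \<le> m" "N = 6 * m + 4" using four_power_eq[OF assms] unfolding N_def by metis
  then have N: "2 < N" "even N" by simp_all
  have S: "merging_set N S" unfolding N_def S_def by (rule merging_set_S_set[OF assms])
  have rot_S: "rot ` S = S" unfolding S_def by (rule S_set_rot)
  have disjoint: "X \<inter> Y = {}" "Y \<inter> Z = {}" "X \<inter> Z = {}"
    unfolding X_def Y_def Z_def by (simp_all add: merged_disjoint[OF N S])
  have cover: "X \<union> Y \<union> Z = edges N"
    unfolding X_def Y_def Z_def by (rule merged_Un[OF N(1) S])
  have Y: "(`) rot ` X = Y" and Z: "(`) rot ` Y = Z"
    unfolding X_def Y_def Z_def by (simp_all add: merged_rot[OF rot_S])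
  have "is_cycle_on (verts N) X" unfolding X_def by (rule merged_CX_is_cycle_on[OF N S])
  moreover have "X \<subseteq> edges N" using cover by blast
  moreover have "0 < N" using N by simp
  ultimately obtain f where f: "dir_ham_cycle N f" "cycle_edges N f = X"
    by (rule is_cycle_on_dir_ham_cycle)
  have ham: "dir_ham_cycle N (rot \<circ> f)" "dir_ham_cycle N (rot \<circ> (rot \<circ> f))"
    using f(1) by (simp_all only: dir_ham_cycle_rot)
  have edges_Y: "cycle_edges N (rot \<circ> f) = Y" by (simp only: cycle_edges_rot f Y)
  then have edges_Z: "cycle_edges N (rot \<circ> (rot \<circ> f)) = Z" by (simp only: cycle_edges_rot f Y Z)
  have hamXYZ: "ham_cycle_edges N X" "ham_cycle_edges N Y" "ham_cycle_edges N Z"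
    unfolding ham_cycle_edges_def using f ham edges_Y edges_Z by blast+
  have rows: "cycle_edges N (perm_act (row_perm srcM 1) \<circ> f) = X"
    "cycle_edges N (perm_act (row_perm srcM 2) \<circ> f) = Y"
    "cycle_edges N (perm_act (row_perm srcM 3) \<circ> f) = Z"
    unfolding perm_act_srcM using f(2) edges_Y edges_Z by (simp_all add: comp_assoc)
  have "edge_img (row_perm srcM 2) X = Y" using Y by (simp add: edge_img_def perm_act_srcM)
  moreover have "edge_img (row_perm srcM 3) X = Z"
    unfolding edge_img_def perm_act_srcM Z[symmetric] Y[symmetric] by (simp add: image_image image_comp)
  moreover have "source_cycle N srcM f"
    unfolding source_cycle_def using latin3_srcM f(1) hamXYZ disjoint cover
    by (simp only: ball_simps rows UN_insert) auto
  ultimately show ?thesis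
    using S hamXYZ disjoint cover f(2)
    unfolding Let_def N_def[symmetric] S_def[symmetric] X_def[symmetric] Y_def[symmetric] Z_def[symmetric]
    by blast
qed

end
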